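(* Let $\theta\in\mathbb{R}$, let $H\in S^3_\theta$ be such that $HH^*$ is invertible, and let $\lambda,\mu\in\mathbb{C}$ be nonzero with $|\lambda|^2+|\mu|^2=1$. Let $(\phi,\psi,\widehat{\psi}):(C_{S^3_{\theta,\mathrm{loc}}},h)\to(C_{T^2_\theta},h')$ be the isometric embedding of the noncommutative torus into the (localized) noncommutative 3-sphere described in the context, given by $\phi(Z)=\lambda U$, $\phi(W)=\mu V$. Then this embedding is minimal if and only if $$\phi\big(\partial_3(HH^* )\big)=\big(|\lambda|^2-|\mu|^2\big)\,\phi(HH^* ).$$
   Context: Let $q=e^{2\pi i\theta}$. 3-sphere. $S^3_\theta$ is the unital complex $\ast$-algebra generated by $Z,Z^*,W,W^*$ with relations $WZ=qZW$, $W^*Z=\bar qZW^*$, $WZ^*=\bar qZ^*W$, $W^*Z^*=qZ^*W^*$, $Z^*Z=ZZ^*$, $W^*W=WW^*$, $WW^*=\mathbb{1}-ZZ^*$. Put $X^1=\frac12(Z+Z^* )$, $X^2=\frac1{2i}(Z-Z^* )$, $X^3=\frac12(W+W^* )$, $X^4=\frac1{2i}(W-W^* )$, $|Z|^2=ZZ^*$, $|W|^2=WW^*$. The elements $|Z|^2,|W|^2$ are central and not zero divisors; $S^3_{\theta,\mathrm{loc}}$ is the localization obtained by adjoining their inverses. $\mathfrak{g}$ is the real Lie algebra generated by the commuting hermitian derivations ($\partial(a^* )=\partial(a)^*$) given by $\partial_1Z=iZ$, $\partial_1W=0$; $\partial_2Z=0$, $\partial_2W=iW$; $\partial_3Z=Z|W|^2$,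 $\partial_3W=-W|Z|^2$, extended to $S^3_{\theta,\mathrm{loc}}$ by the Leibniz rule. $M$ is the free right submodule of $(S^3_{\theta,\mathrm{loc}})^4$ with basis $E_1=(-X^2,X^1,0,0)$, $E_2=(0,0,-X^4,X^3)$, $E_3=(X^1|W|^2,X^2|W|^2,-X^3|Z|^2,-X^4|Z|^2)$; $\varphi:\mathfrak{g}\to M$ is $\mathbb{R}$-linear with $\varphi(\partial_a)=E_a$; $C_{S^3_{\theta,\mathrm{loc}}}=(S^3_{\theta,\mathrm{loc}},\mathfrak{g},M,\varphi)$. The metric is $h(E_am^a,E_bn^b)=\sum_{a,b}(m^a)^*h_{ab}n^b$ with $(h_{ab})=H\,\mathrm{diag}(|Z|^2,|W|^2,|Z|^2|W|^2)\,H^*$. Torus. $T^2_\theta$ is the unital complex $\ast$-algebra generated by unitaries $U,V$ with $VU=qUV$. Put $Y^1=\frac12(U+U^* )$, $Y^2=\frac1{2i}(U-U^* )$, $Y^3=\frac12(V+V^* )$, $Y^4=\frac1{2i}(V-V^* )$. $\mathfrak{g}'$ is the real Lie algebra generated by the commuting hermitian derivations $\delta_1U=iU$, $\delta_1V=0$, $\delta_2U=0$, $\delta_2V=iV$; $M'$ is the free right submodule of $(T^2_\theta)^4$ with basis $e_1=(-Y^2,Y^1,0,0)$, $e_2=(0,0,-Y^4,Y^3)$; $\varphi'(\delta_j)=e_j$ ($\mathbb{R}$-linear); $C_{T^2_\theta}=(T^2_\theta,\mathfrak{g}',M',\varphi')$. Embedding. $\phi:S^3_{\theta,\mathrm{loc}}\to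 T^2_\theta$ is the $\ast$-algebra homomorphism with $\phi(Z)=\lambda U$, $\phi(W)=\mu V$; $\psi:\mathfrak{g}'\to\mathfrak{g}$ is the Lie algebra homomorphism with $\psi(\delta_1)=\partial_1$, $\psi(\delta_2)=\partial_2$; $\Psi=\varphi\circ\psi$; $M_\Psi$ is the submodule of $M$ generated by $E_1,E_2$; $\widehat{\psi}:M_\Psi\to M'$ is $\widehat{\psi}(E_1a+E_2b)=e_1\phi(a)+e_2\phi(b)$. The induced metric $h'$ on $M'$ is the hermitian form with $h'(e_1,e_1)=|\lambda|^2\phi(HH^* )$, $h'(e_1,e_2)=h'(e_2,e_1)=0$, $h'(e_2,e_2)=|\mu|^2\phi(HH^* )$; $(h'^{ij})$ denotes the inverse of the matrix $(h'(e_i,e_j))$. One has $M=M_\Psi\oplus M_\Psi^\perp$, where $M_\Psi^\perp=\{m\in M:h(m,n)=0\ \forall n\in M_\Psi\}$ is the submodule generated by $E_3$. Mean curvature. An affine connection on $(M,\mathfrak{g})$ is a map $(\partial,m)\mapsto\nabla_\partial m$, additive in $m$, $\mathbb{R}$-linear in $\partial$, with $\nabla_\partial(ma)=(\nabla_\partial m)a+m\,\partial(a)$. Let $\nabla$ be the (unique) Levi-Civita connection of $(C_{S^3_{\theta,\mathrm{loc}}},h)$, i.e. the affine connection such that $h(\nabla_{\partial}\varphi(\partial'),\varphi(\partial''))$ is hermitian, $\partial(h(m,n))=h(\nabla_\partial m,n)+h(m,\nabla_\partial n)$, and $\nabla_{\partial}\varphi(\partial')-\nabla_{\partial'}\varphi(\partial)-\varphi([\partial,\partial'])=0$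 for all $\partial,\partial',\partial''\in\mathfrak{g}$, $m,n\in M$. The second fundamental form is $\alpha(\delta,m)=\Pi(\nabla_{\psi(\delta)}m)$ for $\delta\in\mathfrak{g}'$, $m\in M_\Psi$, with $\Pi:M\to M_\Psi^\perp$ the projection along $M_\Psi$. The mean curvature is the map $H_{T^2_\theta}:M\to T^2_\theta$, $H_{T^2_\theta}(m)=\sum_{i,j=1}^2\phi\big(h(m,\alpha(\delta_i,\Psi(\delta_j)))\big)h'^{ij}$. The embedding is minimal if $H_{T^2_\theta}(\xi)=0$ for all $\xi\in M_\Psi^\perp$. *)

theory Defs
  imports Complex_Main "HOL-Algebra.Ring"
begin

section \<open>Unital complex star-algebras\<close>

record 'a star_algebra = "'a ring" +
  cscale :: "complex \<Rightarrow> 'a \<Rightarrow> 'a"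
  adj :: "'a \<Rightarrow> 'a"

locale star_algebra = ring A for A (structure) +
  assumes cscale_closed: "a \<in> carrier A \<Longrightarrow> cscale A c a \<in> carrier A"
    and cscale_add:
      "\<lbrakk>a \<in> carrier A; b \<in> carrier A\<rbrakk>
        \<Longrightarrow> cscale A c (a \<oplus> b) = cscale A c a \<oplus> cscale A c b"
    and add_cscale: "a \<in> carrier A \<Longrightarrow> cscale A (c + d) a = cscale A c a \<oplus> cscale A d a"
    and cscale_cscale: "a \<in> carrier A \<Longrightarrow> cscale A c (cscale A d a) = cscale A (c * d) a"
    and cscale_one: "a \<in> carrier A \<Longrightarrow> cscale A 1 a = a"
    and cscale_mult_left:
      "\<lbrakk>a \<in> carrier A; b \<in> carrier A\<rbrakk> \<Longrightarrow> cscale A c a \<otimes> b = cscale A c (a \<otimes> b)"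
    and cscale_mult_right:
      "\<lbrakk>a \<in> carrier A; b \<in> carrier A\<rbrakk> \<Longrightarrow> a \<otimes> cscale A c b = cscale A c (a \<otimes> b)"
    and adj_closed: "a \<in> carrier A \<Longrightarrow> adj A a \<in> carrier A"
    and adj_add: "\<lbrakk>a \<in> carrier A; b \<in> carrier A\<rbrakk> \<Longrightarrow> adj A (a \<oplus> b) = adj A a \<oplus> adj A b"
    and adj_cscale: "a \<in> carrier A \<Longrightarrow> adj A (cscale A c a) = cscale A (cnj c) (adj A a)"
    and adj_mult: "\<lbrakk>a \<in> carrier A; b \<in> carrier A\<rbrakk> \<Longrightarrow> adj A (a \<otimes> b) = adj A b \<otimes> adj A a"
    and adj_adj: "a \<in> carrier A \<Longrightarrow> adj A (adj A a) = a"

definition star_alg_hom ::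
  "('a, 'c) star_algebra_scheme \<Rightarrow> ('b, 'd) star_algebra_scheme \<Rightarrow> ('a \<Rightarrow> 'b) set"
  where "star_alg_hom A B =
    {f \<in> ring_hom A B.
      (\<forall>a\<in>carrier A. f (adj A a) = adj B (f a)) \<and>
      (\<forall>c. \<forall>a\<in>carrier A. f (cscale A c a) = cscale B c (f a))}"

text \<open>
  The real and imaginary parts \<open>(a + a\<^sup>*) / 2\<close>, \<open>(a - a\<^sup>*) / (2 i)\<close> and the
  square \<open>|a|\<^sup>2 = a a\<^sup>*\<close>.
\<close>

definition re_part :: "('a, 'c) star_algebra_scheme \<Rightarrow> 'a \<Rightarrow> 'a"
  where "re_part A a = cscale A (1 / 2) (a \<oplus>\<^bsub>A\<^esub> adj A a)"

definition im_part :: "('a, 'c) star_algebra_scheme \<Rightarrow> 'a \<Rightarrow> 'a"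
  where "im_part A a = cscale A (1 / (2 * \<i>)) (a \<ominus>\<^bsub>A\<^esub> adj A a)"

definition abs_sq :: "('a, 'c) star_algebra_scheme \<Rightarrow> 'a \<Rightarrow> 'a"
  where "abs_sq A a = a \<otimes>\<^bsub>A\<^esub> adj A a"


section \<open>Star-algebras given by generators and relations\<close>

datatype 'g sterm =
    SGen 'g
  | SZero
  | SOne
  | SAdd "'g sterm" "'g sterm"
  | SMul "'g sterm" "'g sterm"
  | SScale complex "'g sterm"
  | SStar "'g sterm"

text \<open>
  The least congruence on formal expressions that contains the relations \<open>R\<close> and
  makes the laws of a unital complex star-algebra hold.
\<close>

inductive pres_eq :: "('g sterm \<times> 'g sterm) set \<Rightarrow> 'g sterm \<Rightarrow> 'g sterm \<Rightarrow> bool"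
  for R where
  rel: "(s, t) \<in> R \<Longrightarrow> pres_eq R s t"
| refl: "pres_eq R t t"
| sym: "pres_eq R s t \<Longrightarrow> pres_eq R t s"
| trans: "pres_eq R s t \<Longrightarrow> pres_eq R t u \<Longrightarrow> pres_eq R s u"
| cong_add: "pres_eq R s s' \<Longrightarrow> pres_eq R t t' \<Longrightarrow> pres_eq R (SAdd s t) (SAdd s' t')"
| cong_mul: "pres_eq R s s' \<Longrightarrow> pres_eq R t t' \<Longrightarrow> pres_eq R (SMul s t) (SMul s' t')"
| cong_scale: "pres_eq R t t' \<Longrightarrow> pres_eq R (SScale c t) (SScale c t')"
| cong_star: "pres_eq R t t' \<Longrightarrow> pres_eq R (SStar t) (SStar t')"
| add_assoc: "pres_eq R (SAdd (SAdd s t) u) (SAdd s (SAdd t u))"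
| add_comm: "pres_eq R (SAdd s t) (SAdd t s)"
| add_zero: "pres_eq R (SAdd SZero t) t"
| add_inv: "pres_eq R (SAdd (SScale (-1) t) t) SZero"
| mul_assoc: "pres_eq R (SMul (SMul s t) u) (SMul s (SMul t u))"
| one_mul: "pres_eq R (SMul SOne t) t"
| mul_one: "pres_eq R (SMul t SOne) t"
| distrib_left: "pres_eq R (SMul u (SAdd s t)) (SAdd (SMul u s) (SMul u t))"
| distrib_right: "pres_eq R (SMul (SAdd s t) u) (SAdd (SMul s u) (SMul t u))"
| scale_add: "pres_eq R (SScale c (SAdd s t)) (SAdd (SScale c s) (SScale c t))"
| add_scale: "pres_eq R (SScale (c + d) t) (SAdd (SScale c t) (SScale d t))"
| scale_scale: "pres_eq R (SScale c (SScale d t)) (SScale (c * d) t)"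
| scale_one: "pres_eq R (SScale 1 t) t"
| scale_mul_left: "pres_eq R (SMul (SScale c s) t) (SScale c (SMul s t))"
| scale_mul_right: "pres_eq R (SMul s (SScale c t)) (SScale c (SMul s t))"
| star_add: "pres_eq R (SStar (SAdd s t)) (SAdd (SStar s) (SStar t))"
| star_scale: "pres_eq R (SStar (SScale c t)) (SScale (cnj c) (SStar t))"
| star_mul: "pres_eq R (SStar (SMul s t)) (SMul (SStar t) (SStar s))"
| star_star: "pres_eq R (SStar (SStar t)) t"

definition cls :: "('g sterm \<times> 'g sterm) set \<Rightarrow> 'g sterm \<Rightarrow> 'g sterm set"
  where "cls R t = {u. pres_eq R t u}"

definition presented :: "('g sterm \<times> 'g sterm) set \<Rightarrow> 'g sterm set star_algebra"
  where "presented R =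
    \<lparr>carrier = range (cls R),
     mult = (\<lambda>X Y. \<Union>x\<in>X. \<Union>y\<in>Y. cls R (SMul x y)),
     one = cls R SOne,
     zero = cls R SZero,
     add = (\<lambda>X Y. \<Union>x\<in>X. \<Union>y\<in>Y. cls R (SAdd x y)),
     cscale = (\<lambda>c X. \<Union>x\<in>X. cls R (SScale c x)),
     adj = (\<lambda>X. \<Union>x\<in>X. cls R (SStar x))\<rparr>"

lemma cls_eq_iff: "cls R s = cls R t \<longleftrightarrow> pres_eq R s t"
  unfolding cls_def using pres_eq.refl pres_eq.sym pres_eq.trans by blast

lemma cls_lift1:
  assumes "\<And>x. pres_eq R s x \<Longrightarrow> f x = f s"
  shows "(\<Union>x\<in>cls R s. f x) = f s"
proof -
  have "(\<Union>x\<in>cls R s. f x) = (\<Union>x\<in>cls R s. f s)"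
    by (rule SUP_cong) (simp_all add: cls_def assms)
  moreover have "s \<in> cls R s"
    by (simp add: cls_def pres_eq.refl)
  ultimately show ?thesis by (metis UN_constant empty_iff)
qed

lemma presented_simps:
  "carrier (presented R) = range (cls R)"
  "one (presented R) = cls R SOne"
  "zero (presented R) = cls R SZero"
  "mult (presented R) (cls R s) (cls R t) = cls R (SMul s t)"
  "add (presented R) (cls R s) (cls R t) = cls R (SAdd s t)"
  "cscale (presented R) c (cls R t) = cls R (SScale c t)"
  "adj (presented R) (cls R t) = cls R (SStar t)"
proof -
  have eq: "cls R (f x) = cls R (f s)"
    if "\<And>u v. pres_eq R u v \<Longrightarrow> pres_eq R (f u) (f v)" "pres_eq R s x" for f s x
    unfolding cls_eq_iff by (rule that(1)) (rule pres_eq.sym, rule that(2))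
  have lift: "(\<Union>x\<in>cls R s. cls R (f x)) = cls R (f s)"
    if "\<And>u v. pres_eq R u v \<Longrightarrow> pres_eq R (f u) (f v)" for f s
    by (rule cls_lift1) (rule eq[OF that])
  have lift2: "(\<Union>x\<in>cls R s. \<Union>y\<in>cls R t. cls R (f x y)) = cls R (f s t)"
    if "\<And>u v u' v'. pres_eq R u v \<Longrightarrow> pres_eq R u' v' \<Longrightarrow> pres_eq R (f u u') (f v v')"
    for f s t
  proof -
    have "(\<Union>x\<in>cls R s. \<Union>y\<in>cls R t. cls R (f x y)) = (\<Union>x\<in>cls R s. cls R (f x t))"
      by (rule SUP_cong[OF HOL.refl]) (rule lift, rule that[OF pres_eq.refl])
    also have "\<dots> = cls R (f s t)"
      by (rule lift) (rule that[OF _ pres_eq.refl])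
    finally show ?thesis .
  qed
  show "mult (presented R) (cls R s) (cls R t) = cls R (SMul s t)"
    by (simp add: presented_def lift2 pres_eq.cong_mul)
  show "add (presented R) (cls R s) (cls R t) = cls R (SAdd s t)"
    by (simp add: presented_def lift2 pres_eq.cong_add)
  show "cscale (presented R) c (cls R t) = cls R (SScale c t)"
    by (simp add: presented_def lift pres_eq.cong_scale)
  show "adj (presented R) (cls R t) = cls R (SStar t)"
    by (simp add: presented_def lift pres_eq.cong_star)
qed (simp_all add: presented_def)

lemmas pres_eq_laws =
  pres_eq.add_assoc pres_eq.add_comm pres_eq.add_zero
  pres_eq.mul_assoc pres_eq.one_mul pres_eq.mul_one pres_eq.distrib_left pres_eq.distrib_right
  pres_eq.scale_add pres_eq.add_scale pres_eq.scale_scale pres_eq.scale_one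
  pres_eq.scale_mul_left pres_eq.scale_mul_right
  pres_eq.star_add pres_eq.star_scale pres_eq.star_mul pres_eq.star_star

lemma presented_star_algebra: "star_algebra (presented R)"
proof -
  interpret abelian_group "presented R"
  proof (rule abelian_groupI)
    fix X assume "X \<in> carrier (presented R)"
    then obtain t where "X = cls R t" by (auto simp: presented_simps)
    then have "cls R (SScale (-1) t) \<oplus>\<^bsub>presented R\<^esub> X = \<zero>\<^bsub>presented R\<^esub>"
      by (simp add: presented_simps cls_eq_iff pres_eq.add_inv)
    then show "\<exists>Y\<in>carrier (presented R). Y \<oplus>\<^bsub>presented R\<^esub> X = \<zero>\<^bsub>presented R\<^esub>"
      by (auto simp: presented_simps)
  qed (clarsimp simp: presented_simps rangeI cls_eq_iff pres_eq_laws)+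
  interpret monoid "presented R"
    by (rule monoidI) (clarsimp simp: presented_simps rangeI cls_eq_iff pres_eq_laws)+
  interpret ring "presented R"
    by (rule ringI)
      (clarsimp simp: presented_simps rangeI cls_eq_iff pres_eq_laws abelian_group_axioms monoid_axioms)+
  show ?thesis
    by (intro star_algebra.intro star_algebra_axioms.intro ring_axioms)
      (clarsimp simp: presented_simps rangeI cls_eq_iff pres_eq_laws)+
qed


section \<open>The noncommutative 3-sphere, its localization, and the noncommutative torus\<close>

definition qpar :: "real \<Rightarrow> complex"
  where "qpar \<theta> = exp (2 * of_real pi * \<i> * of_real \<theta>)"

datatype s3_gen = GenZ | GenW

definition s3_rels :: "real \<Rightarrow> (s3_gen sterm \<times> s3_gen sterm) set"
  where "s3_rels \<theta> =
    (let q = qpar \<theta>; Z = SGen GenZ; W = SGen GenW; Z' = SStar Z; W' = SStar W in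
      {(SMul W Z, SScale q (SMul Z W)),
       (SMul W' Z, SScale (cnj q) (SMul Z W')),
       (SMul W Z', SScale (cnj q) (SMul Z' W)),
       (SMul W' Z', SScale q (SMul Z' W')),
       (SMul Z' Z, SMul Z Z'),
       (SMul W' W, SMul W W'),
       (SMul W W', SAdd SOne (SScale (-1) (SMul Z Z')))})"

definition S3 :: "real \<Rightarrow> s3_gen sterm set star_algebra"
  where "S3 \<theta> = presented (s3_rels \<theta>)"

text \<open>
  The localization adjoins to the presentation two-sided inverses of \<open>|Z|\<^sup>2\<close> and
  \<open>|W|\<^sup>2\<close>; \<open>to_loc\<close> is the canonical map from the sphere to its localization.
\<close>

datatype s3loc_gen = Base s3_gen | InvZ | InvW

definition s3loc_rels :: "real \<Rightarrow> (s3loc_gen sterm \<times> s3loc_gen sterm) set"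
  where "s3loc_rels \<theta> =
    (let Z = SGen (Base GenZ); W = SGen (Base GenW);
         z = SMul Z (SStar Z); w = SMul W (SStar W) in
      map_prod (map_sterm Base) (map_sterm Base) ` s3_rels \<theta> \<union>
      {(SMul (SGen InvZ) z, SOne), (SMul z (SGen InvZ), SOne),
       (SMul (SGen InvW) w, SOne), (SMul w (SGen InvW), SOne)})"

type_synonym s3loc = "s3loc_gen sterm set"

definition S3loc :: "real \<Rightarrow> s3loc star_algebra"
  where "S3loc \<theta> = presented (s3loc_rels \<theta>)"

definition to_loc :: "real \<Rightarrow> s3_gen sterm set \<Rightarrow> s3loc"
  where "to_loc \<theta> X = (\<Union>t\<in>X. cls (s3loc_rels \<theta>) (map_sterm Base t))"

definition Zel :: "real \<Rightarrow> s3loc"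
  where "Zel \<theta> = cls (s3loc_rels \<theta>) (SGen (Base GenZ))"

definition Wel :: "real \<Rightarrow> s3loc"
  where "Wel \<theta> = cls (s3loc_rels \<theta>) (SGen (Base GenW))"

datatype t2_gen = GenU | GenV

definition t2_rels :: "real \<Rightarrow> (t2_gen sterm \<times> t2_gen sterm) set"
  where "t2_rels \<theta> =
    (let U = SGen GenU; V = SGen GenV in
      {(SMul U (SStar U), SOne), (SMul (SStar U) U, SOne),
       (SMul V (SStar V), SOne), (SMul (SStar V) V, SOne),
       (SMul V U, SScale (qpar \<theta>) (SMul U V))})"

type_synonym t2 = "t2_gen sterm set"

definition T2 :: "real \<Rightarrow> t2 star_algebra"
  where "T2 \<theta> = presented (t2_rels \<theta>)"

definition Uel :: "real \<Rightarrow> t2"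
  where "Uel \<theta> = cls (t2_rels \<theta>) (SGen GenU)"

definition Vel :: "real \<Rightarrow> t2"
  where "Vel \<theta> = cls (t2_rels \<theta>) (SGen GenV)"


section \<open>Derivations\<close>

text \<open>
  Derivations of \<open>A\<close> are taken to be \<open>undefined\<close> outside the carrier of \<open>A\<close>, so that
  equality of derivations is equality of functions on the carrier.
\<close>

definition hermitian_derivation :: "('a, 'c) star_algebra_scheme \<Rightarrow> ('a \<Rightarrow> 'a) \<Rightarrow> bool"
  where "hermitian_derivation A d \<longleftrightarrow>
    d \<in> carrier A \<rightarrow>\<^sub>E carrier A \<and>
    (\<forall>a\<in>carrier A. \<forall>b\<in>carrier A. d (a \<oplus>\<^bsub>A\<^esub> b) = d a \<oplus>\<^bsub>A\<^esub> d b) \<and>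
    (\<forall>c. \<forall>a\<in>carrier A. d (cscale A c a) = cscale A c (d a)) \<and>
    (\<forall>a\<in>carrier A. \<forall>b\<in>carrier A.
      d (a \<otimes>\<^bsub>A\<^esub> b) = d a \<otimes>\<^bsub>A\<^esub> b \<oplus>\<^bsub>A\<^esub> a \<otimes>\<^bsub>A\<^esub> d b) \<and>
    (\<forall>a\<in>carrier A. d (adj A a) = adj A (d a))"

definition der_add ::
  "('a, 'c) star_algebra_scheme \<Rightarrow> ('a \<Rightarrow> 'a) \<Rightarrow> ('a \<Rightarrow> 'a) \<Rightarrow> 'a \<Rightarrow> 'a"
  where "der_add A d e = (\<lambda>a\<in>carrier A. d a \<oplus>\<^bsub>A\<^esub> e a)"

definition der_scale ::
  "('a, 'c) star_algebra_scheme \<Rightarrow> real \<Rightarrow> ('a \<Rightarrow> 'a) \<Rightarrow> 'a \<Rightarrow> 'a"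
  where "der_scale A r d = (\<lambda>a\<in>carrier A. cscale A (of_real r) (d a))"

definition der_bracket ::
  "('a, 'c) star_algebra_scheme \<Rightarrow> ('a \<Rightarrow> 'a) \<Rightarrow> ('a \<Rightarrow> 'a) \<Rightarrow> 'a \<Rightarrow> 'a"
  where "der_bracket A d e = (\<lambda>a\<in>carrier A. d (e a) \<ominus>\<^bsub>A\<^esub> e (d a))"

inductive_set lie_generated ::
  "('a, 'c) star_algebra_scheme \<Rightarrow> ('a \<Rightarrow> 'a) set \<Rightarrow> ('a \<Rightarrow> 'a) set"
  for A :: "('a, 'c) star_algebra_scheme" and D :: "('a \<Rightarrow> 'a) set" where
  gen: "d \<in> D \<Longrightarrow> d \<in> lie_generated A D"
| add: "\<lbrakk>d \<in> lie_generated A D; e \<in> lie_generated A D\<rbrakk> \<Longrightarrow> der_add A d e \<in> lie_generated A D"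
| scale: "d \<in> lie_generated A D \<Longrightarrow> der_scale A r d \<in> lie_generated A D"
| bracket:
    "\<lbrakk>d \<in> lie_generated A D; e \<in> lie_generated A D\<rbrakk> \<Longrightarrow> der_bracket A d e \<in> lie_generated A D"

definition lie_hom ::
  "('a, 'c) star_algebra_scheme \<Rightarrow> ('a \<Rightarrow> 'a) set \<Rightarrow>
   ('b, 'd) star_algebra_scheme \<Rightarrow> ('b \<Rightarrow> 'b) set \<Rightarrow> (('a \<Rightarrow> 'a) \<Rightarrow> 'b \<Rightarrow> 'b) \<Rightarrow> bool"
  where "lie_hom A g B k f \<longleftrightarrow>
    f \<in> g \<rightarrow> k \<and>
    (\<forall>d\<in>g. \<forall>e\<in>g. f (der_add A d e) = der_add B (f d) (f e)) \<and>
    (\<forall>r. \<forall>d\<in>g. f (der_scale A r d) = der_scale B r (f d)) \<and>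
    (\<forall>d\<in>g. \<forall>e\<in>g. f (der_bracket A d e) = der_bracket B (f d) (f e))"


section \<open>Right modules, forms and connections\<close>

text \<open>
  As for the modules of the algebra library, the multiplicative fields of the underlying
  ring record are not used.
\<close>

record ('a, 'm) rmodule = "'m ring" +
  ract :: "'m \<Rightarrow> 'a \<Rightarrow> 'm"

definition free_rmodule :: "('a, 'c) star_algebra_scheme \<Rightarrow> nat \<Rightarrow> ('a, 'a list) rmodule"
  where "free_rmodule A n =
    \<lparr>carrier = {v. length v = n \<and> set v \<subseteq> carrier A},
     mult = undefined,
     one = undefined,
     zero = replicate n \<zero>\<^bsub>A\<^esub>,
     add = map2 (add A),
     ract = (\<lambda>v a. map (\<lambda>x. x \<otimes>\<^bsub>A\<^esub> a) v)\<rparr>"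

definition lincomb :: "('a, 'm) rmodule \<Rightarrow> nat set \<Rightarrow> (nat \<Rightarrow> 'm) \<Rightarrow> (nat \<Rightarrow> 'a) \<Rightarrow> 'm"
  where "lincomb M I E c = (\<Oplus>\<^bsub>M\<^esub>i\<in>I. ract M (E i) (c i))"

definition generated_submodule ::
  "('a, 'c) star_algebra_scheme \<Rightarrow> ('a, 'm) rmodule \<Rightarrow> nat set \<Rightarrow> (nat \<Rightarrow> 'm) \<Rightarrow> ('a, 'm) rmodule"
  where "generated_submodule A M I E = M\<lparr>carrier := lincomb M I E ` (I \<rightarrow> carrier A)\<rparr>"

definition rscale :: "('a, 'c) star_algebra_scheme \<Rightarrow> ('a, 'm) rmodule \<Rightarrow> real \<Rightarrow> 'm \<Rightarrow> 'm"
  where "rscale A M r m = ract M m (cscale A (of_real r) \<one>\<^bsub>A\<^esub>)"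

definition real_linear ::
  "('a, 'c) star_algebra_scheme \<Rightarrow> ('a \<Rightarrow> 'a) set \<Rightarrow> ('a, 'm) rmodule \<Rightarrow> (('a \<Rightarrow> 'a) \<Rightarrow> 'm) \<Rightarrow> bool"
  where "real_linear A g M f \<longleftrightarrow>
    f \<in> g \<rightarrow> carrier M \<and>
    (\<forall>d\<in>g. \<forall>e\<in>g. f (der_add A d e) = f d \<oplus>\<^bsub>M\<^esub> f e) \<and>
    (\<forall>r. \<forall>d\<in>g. f (der_scale A r d) = rscale A M r (f d))"

definition hermitian_form ::
  "('a, 'c) star_algebra_scheme \<Rightarrow> ('a, 'm) rmodule \<Rightarrow> ('m \<Rightarrow> 'm \<Rightarrow> 'a) \<Rightarrow> bool"
  where "hermitian_form A M h \<longleftrightarrow>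
    (\<forall>m\<in>carrier M. \<forall>n\<in>carrier M. h m n \<in> carrier A) \<and>
    (\<forall>m\<in>carrier M. \<forall>n\<in>carrier M. \<forall>p\<in>carrier M. h m (n \<oplus>\<^bsub>M\<^esub> p) = h m n \<oplus>\<^bsub>A\<^esub> h m p) \<and>
    (\<forall>m\<in>carrier M. \<forall>n\<in>carrier M. \<forall>a\<in>carrier A. h m (ract M n a) = h m n \<otimes>\<^bsub>A\<^esub> a) \<and>
    (\<forall>m\<in>carrier M. \<forall>n\<in>carrier M. adj A (h m n) = h n m)"

definition matrix_form ::
  "('a, 'c) star_algebra_scheme \<Rightarrow> ('a, 'm) rmodule \<Rightarrow> nat set \<Rightarrow> (nat \<Rightarrow> 'm) \<Rightarrow>
   (nat \<Rightarrow> nat \<Rightarrow> 'a) \<Rightarrow> ('m \<Rightarrow> 'm \<Rightarrow> 'a) \<Rightarrow> bool"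
  where "matrix_form A M I E K h \<longleftrightarrow>
    (\<forall>m \<in> I \<rightarrow> carrier A. \<forall>n \<in> I \<rightarrow> carrier A.
      h (lincomb M I E m) (lincomb M I E n) =
        (\<Oplus>\<^bsub>A\<^esub>a\<in>I. \<Oplus>\<^bsub>A\<^esub>b\<in>I. adj A (m a) \<otimes>\<^bsub>A\<^esub> K a b \<otimes>\<^bsub>A\<^esub> n b))"

definition inverse_matrix ::
  "('a, 'c) ring_scheme \<Rightarrow> nat set \<Rightarrow> (nat \<Rightarrow> nat \<Rightarrow> 'a) \<Rightarrow> (nat \<Rightarrow> nat \<Rightarrow> 'a) \<Rightarrow> bool"
  where "inverse_matrix A I K N \<longleftrightarrow>
    (\<forall>i\<in>I. \<forall>j\<in>I. N i j \<in> carrier A) \<and>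
    (\<forall>i\<in>I. \<forall>j\<in>I. (\<Oplus>\<^bsub>A\<^esub>k\<in>I. K i k \<otimes>\<^bsub>A\<^esub> N k j) = (if i = j then \<one>\<^bsub>A\<^esub> else \<zero>\<^bsub>A\<^esub>)) \<and>
    (\<forall>i\<in>I. \<forall>j\<in>I. (\<Oplus>\<^bsub>A\<^esub>k\<in>I. N i k \<otimes>\<^bsub>A\<^esub> K k j) = (if i = j then \<one>\<^bsub>A\<^esub> else \<zero>\<^bsub>A\<^esub>))"

text \<open>A real calculus \<open>(A, g, M, \<phi>)\<close>.\<close>

record ('a, 'm) real_calculus =
  rc_alg :: "'a star_algebra"
  rc_lie :: "('a \<Rightarrow> 'a) set"
  rc_mod :: "('a, 'm) rmodule"
  rc_map :: "('a \<Rightarrow> 'a) \<Rightarrow> 'm"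

definition affine_connection ::
  "'a star_algebra \<Rightarrow> ('a \<Rightarrow> 'a) set \<Rightarrow> ('a, 'm) rmodule \<Rightarrow> (('a \<Rightarrow> 'a) \<Rightarrow> 'm \<Rightarrow> 'm) \<Rightarrow> bool"
  where "affine_connection A g M nab \<longleftrightarrow>
    (\<forall>d\<in>g. \<forall>m\<in>carrier M. nab d m \<in> carrier M) \<and>
    (\<forall>d\<in>g. \<forall>m\<in>carrier M. \<forall>n\<in>carrier M. nab d (m \<oplus>\<^bsub>M\<^esub> n) = nab d m \<oplus>\<^bsub>M\<^esub> nab d n) \<and>
    (\<forall>d\<in>g. \<forall>e\<in>g. \<forall>m\<in>carrier M. nab (der_add A d e) m = nab d m \<oplus>\<^bsub>M\<^esub> nab e m) \<and>
    (\<forall>r. \<forall>d\<in>g. \<forall>m\<in>carrier M. nab (der_scale A r d) m = rscale A M r (nab d m)) \<and>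
    (\<forall>d\<in>g. \<forall>m\<in>carrier M. \<forall>a\<in>carrier A.
      nab d (ract M m a) = ract M (nab d m) a \<oplus>\<^bsub>M\<^esub> ract M m (d a))"

definition levi_civita ::
  "('a, 'm) real_calculus \<Rightarrow> ('m \<Rightarrow> 'm \<Rightarrow> 'a) \<Rightarrow> (('a \<Rightarrow> 'a) \<Rightarrow> 'm \<Rightarrow> 'm) \<Rightarrow> bool"
  where "levi_civita C h nab \<longleftrightarrow>
    (let A = rc_alg C; g = rc_lie C; M = rc_mod C; \<phi> = rc_map C in
      affine_connection A g M nab \<and>
      (\<forall>d\<in>g. \<forall>e\<in>g. \<forall>f\<in>g. adj A (h (nab d (\<phi> e)) (\<phi> f)) = h (nab d (\<phi> e)) (\<phi> f)) \<and>
      (\<forall>d\<in>g. \<forall>m\<in>carrier M. \<forall>n\<in>carrier M.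
        d (h m n) = h (nab d m) n \<oplus>\<^bsub>A\<^esub> h m (nab d n)) \<and>
      (\<forall>d\<in>g. \<forall>e\<in>g.
        nab d (\<phi> e) \<ominus>\<^bsub>M\<^esub> nab e (\<phi> d) \<ominus>\<^bsub>M\<^esub> \<phi> (der_bracket A d e) = \<zero>\<^bsub>M\<^esub>))"


section \<open>Mean curvature\<close>

definition orth_compl ::
  "'a star_algebra \<Rightarrow> ('a, 'm) rmodule \<Rightarrow> ('m \<Rightarrow> 'm \<Rightarrow> 'a) \<Rightarrow> ('a, 'm) rmodule \<Rightarrow> 'm set"
  where "orth_compl A M h N = {m \<in> carrier M. \<forall>n\<in>carrier N. h m n = \<zero>\<^bsub>A\<^esub>}"

definition normal_proj ::
  "'a star_algebra \<Rightarrow> ('a, 'm) rmodule \<Rightarrow> ('m \<Rightarrow> 'm \<Rightarrow> 'a) \<Rightarrow> ('a, 'm) rmodule \<Rightarrow> 'm \<Rightarrow> 'm"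
  where "normal_proj A M h N m =
    (THE p. p \<in> orth_compl A M h N \<and> (\<exists>n\<in>carrier N. m = n \<oplus>\<^bsub>M\<^esub> p))"

definition second_fundamental_form ::
  "('a, 'm) real_calculus \<Rightarrow> ('m \<Rightarrow> 'm \<Rightarrow> 'a) \<Rightarrow> (('a \<Rightarrow> 'a) \<Rightarrow> 'm \<Rightarrow> 'm) \<Rightarrow>
   ('a, 'm) rmodule \<Rightarrow> (('b \<Rightarrow> 'b) \<Rightarrow> 'a \<Rightarrow> 'a) \<Rightarrow> ('b \<Rightarrow> 'b) \<Rightarrow> 'm \<Rightarrow> 'm"
  where "second_fundamental_form C h nab MPsi psi \<delta> m =
    normal_proj (rc_alg C) (rc_mod C) h MPsi (nab (psi \<delta>) m)"

text \<open>
  \<open>\<delta>\<close> lists the generating derivations of the embedded object, indexed by \<open>I\<close>, and \<open>hinv\<close> is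
  the inverse matrix of the induced metric.
\<close>

definition mean_curvature ::
  "('a, 'm) real_calculus \<Rightarrow> ('m \<Rightarrow> 'm \<Rightarrow> 'a) \<Rightarrow> (('a \<Rightarrow> 'a) \<Rightarrow> 'm \<Rightarrow> 'm) \<Rightarrow>
   ('a, 'm) rmodule \<Rightarrow> 'b star_algebra \<Rightarrow> nat set \<Rightarrow> (nat \<Rightarrow> 'b \<Rightarrow> 'b) \<Rightarrow>
   (nat \<Rightarrow> nat \<Rightarrow> 'b) \<Rightarrow> ('a \<Rightarrow> 'b) \<Rightarrow> (('b \<Rightarrow> 'b) \<Rightarrow> 'a \<Rightarrow> 'a) \<Rightarrow> 'm \<Rightarrow> 'b"
  where "mean_curvature C h nab MPsi B I \<delta> hinv phi psi m =
    (\<Oplus>\<^bsub>B\<^esub>i\<in>I. \<Oplus>\<^bsub>B\<^esub>j\<in>I.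
      phi (h m (second_fundamental_form C h nab MPsi psi (\<delta> i) (rc_map C (psi (\<delta> j)))))
        \<otimes>\<^bsub>B\<^esub> hinv i j)"

definition minimal_embedding ::
  "('a, 'm) real_calculus \<Rightarrow> ('m \<Rightarrow> 'm \<Rightarrow> 'a) \<Rightarrow> (('a \<Rightarrow> 'a) \<Rightarrow> 'm \<Rightarrow> 'm) \<Rightarrow>
   ('a, 'm) rmodule \<Rightarrow> 'b star_algebra \<Rightarrow> nat set \<Rightarrow> (nat \<Rightarrow> 'b \<Rightarrow> 'b) \<Rightarrow>
   (nat \<Rightarrow> nat \<Rightarrow> 'b) \<Rightarrow> ('a \<Rightarrow> 'b) \<Rightarrow> (('b \<Rightarrow> 'b) \<Rightarrow> 'a \<Rightarrow> 'a) \<Rightarrow> bool"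
  where "minimal_embedding C h nab MPsi B I \<delta> hinv phi psi \<longleftrightarrow>
    (\<forall>\<xi> \<in> orth_compl (rc_alg C) (rc_mod C) h MPsi.
      mean_curvature C h nab MPsi B I \<delta> hinv phi psi \<xi> = \<zero>\<^bsub>B\<^esub>)"


section \<open>The real calculus of the localized 3-sphere\<close>

definition s3_derivations :: "real \<Rightarrow> (nat \<Rightarrow> s3loc \<Rightarrow> s3loc) \<Rightarrow> bool"
  where "s3_derivations \<theta> d \<longleftrightarrow>
    (let A = S3loc \<theta>; Z = Zel \<theta>; W = Wel \<theta> in
      (\<forall>a\<in>{1, 2, 3}. hermitian_derivation A (d a)) \<and>
      d 1 Z = cscale A \<i> Z \<and> d 1 W = \<zero>\<^bsub>A\<^esub> \<and>
      d 2 Z = \<zero>\<^bsub>A\<^esub> \<and> d 2 W = cscale A \<i> W \<and>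
      d 3 Z = Z \<otimes>\<^bsub>A\<^esub> abs_sq A W \<and> d 3 W = \<ominus>\<^bsub>A\<^esub> (W \<otimes>\<^bsub>A\<^esub> abs_sq A Z))"

definition s3_basis :: "real \<Rightarrow> nat \<Rightarrow> s3loc list"
  where "s3_basis \<theta> a =
    (let A = S3loc \<theta>; Z = Zel \<theta>; W = Wel \<theta>;
         X1 = re_part A Z; X2 = im_part A Z; X3 = re_part A W; X4 = im_part A W;
         z = abs_sq A Z; w = abs_sq A W in
      if a = 1 then [\<ominus>\<^bsub>A\<^esub> X2, X1, \<zero>\<^bsub>A\<^esub>, \<zero>\<^bsub>A\<^esub>]
      else if a = 2 then [\<zero>\<^bsub>A\<^esub>, \<zero>\<^bsub>A\<^esub>, \<ominus>\<^bsub>A\<^esub> X4, X3]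
      else [X1 \<otimes>\<^bsub>A\<^esub> w, X2 \<otimes>\<^bsub>A\<^esub> w, \<ominus>\<^bsub>A\<^esub> (X3 \<otimes>\<^bsub>A\<^esub> z), \<ominus>\<^bsub>A\<^esub> (X4 \<otimes>\<^bsub>A\<^esub> z)])"

definition s3_module :: "real \<Rightarrow> (s3loc, s3loc list) rmodule"
  where "s3_module \<theta> =
    generated_submodule (S3loc \<theta>) (free_rmodule (S3loc \<theta>) 4) {1, 2, 3} (s3_basis \<theta>)"

definition s3_tangent_module :: "real \<Rightarrow> (s3loc, s3loc list) rmodule"
  where "s3_tangent_module \<theta> =
    generated_submodule (S3loc \<theta>) (s3_module \<theta>) {1, 2} (s3_basis \<theta>)"

definition s3_calculus ::
  "real \<Rightarrow> (nat \<Rightarrow> s3loc \<Rightarrow> s3loc) \<Rightarrow> (s3loc, s3loc list) real_calculus \<Rightarrow> bool"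
  where "s3_calculus \<theta> d C \<longleftrightarrow>
    s3_derivations \<theta> d \<and>
    rc_alg C = S3loc \<theta> \<and>
    rc_lie C = lie_generated (S3loc \<theta>) (d ` {1, 2, 3}) \<and>
    rc_mod C = s3_module \<theta> \<and>
    real_linear (S3loc \<theta>) (rc_lie C) (s3_module \<theta>) (rc_map C) \<and>
    (\<forall>a\<in>{1, 2, 3}. rc_map C (d a) = s3_basis \<theta> a)"

definition s3_metric_matrix :: "real \<Rightarrow> s3loc \<Rightarrow> nat \<Rightarrow> nat \<Rightarrow> s3loc"
  where "s3_metric_matrix \<theta> H a b =
    (let A = S3loc \<theta>; z = abs_sq A (Zel \<theta>); w = abs_sq A (Wel \<theta>);
         D = (if a \<noteq> b then \<zero>\<^bsub>A\<^esub>
              else if a = 1 then z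
              else if a = 2 then w
              else z \<otimes>\<^bsub>A\<^esub> w) in
      H \<otimes>\<^bsub>A\<^esub> D \<otimes>\<^bsub>A\<^esub> adj A H)"


section \<open>The real calculus of the noncommutative torus\<close>

definition t2_derivations :: "real \<Rightarrow> (nat \<Rightarrow> t2 \<Rightarrow> t2) \<Rightarrow> bool"
  where "t2_derivations \<theta> \<delta> \<longleftrightarrow>
    (let B = T2 \<theta>; U = Uel \<theta>; V = Vel \<theta> in
      (\<forall>j\<in>{1, 2}. hermitian_derivation B (\<delta> j)) \<and>
      \<delta> 1 U = cscale B \<i> U \<and> \<delta> 1 V = \<zero>\<^bsub>B\<^esub> \<and>
      \<delta> 2 U = \<zero>\<^bsub>B\<^esub> \<and> \<delta> 2 V = cscale B \<i> V)"

definition t2_basis :: "real \<Rightarrow> nat \<Rightarrow> t2 list"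
  where "t2_basis \<theta> j =
    (let B = T2 \<theta>; U = Uel \<theta>; V = Vel \<theta>;
         Y1 = re_part B U; Y2 = im_part B U; Y3 = re_part B V; Y4 = im_part B V in
      if j = 1 then [\<ominus>\<^bsub>B\<^esub> Y2, Y1, \<zero>\<^bsub>B\<^esub>, \<zero>\<^bsub>B\<^esub>]
      else [\<zero>\<^bsub>B\<^esub>, \<zero>\<^bsub>B\<^esub>, \<ominus>\<^bsub>B\<^esub> Y4, Y3])"

definition t2_module :: "real \<Rightarrow> (t2, t2 list) rmodule"
  where "t2_module \<theta> =
    generated_submodule (T2 \<theta>) (free_rmodule (T2 \<theta>) 4) {1, 2} (t2_basis \<theta>)"

definition t2_calculus ::
  "real \<Rightarrow> (nat \<Rightarrow> t2 \<Rightarrow> t2) \<Rightarrow> (t2, t2 list) real_calculus \<Rightarrow> bool"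
  where "t2_calculus \<theta> \<delta> C \<longleftrightarrow>
    t2_derivations \<theta> \<delta> \<and>
    rc_alg C = T2 \<theta> \<and>
    rc_lie C = lie_generated (T2 \<theta>) (\<delta> ` {1, 2}) \<and>
    rc_mod C = t2_module \<theta> \<and>
    real_linear (T2 \<theta>) (rc_lie C) (t2_module \<theta>) (rc_map C) \<and>
    (\<forall>j\<in>{1, 2}. rc_map C (\<delta> j) = t2_basis \<theta> j)"


end

theory Submission
  imports Defs
begin

text \<open>
  Write \<open>z = |Z|\<^sup>2\<close>, \<open>w = |W|\<^sup>2\<close> and \<open>k = H H\<^sup>*\<close>. Since \<open>z\<close> and \<open>w\<close> are central, the metric is diagonal
  in the frame \<open>E\<^sub>1, E\<^sub>2, E\<^sub>3\<close> with entries \<open>z k\<close>, \<open>w k\<close>, \<open>z w k\<close>, all invertible. Hence the normal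
  module is spanned by \<open>E\<^sub>3\<close>, and only \<open>h (E\<^sub>3, \<nabla>\<^sub>i E\<^sub>i)\<close> enters the mean curvature. As the derivations
  commute, the Koszul formula gives \<open>h (E\<^sub>3, \<nabla>\<^sub>i E\<^sub>i) = - \<partial>\<^sub>3 h\<^sub>i\<^sub>i / 2\<close>. With \<open>\<partial>\<^sub>3 z = 2 z w = - \<partial>\<^sub>3 w\<close>,
  \<open>\<phi> z = |\<lambda>|\<^sup>2\<close> and \<open>\<phi> w = |\<mu>|\<^sup>2\<close>, the mean curvature of \<open>E\<^sub>3 c\<close> is
  \<open>\<phi>(c)\<^sup>* ((|\<lambda>|\<^sup>2 - |\<mu>|\<^sup>2) \<phi>(k) - \<phi>(\<partial>\<^sub>3 k)) \<phi>(k)\<^sup>-\<^sup>1\<close>.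
\<close>

section \<open>Hermitian derivations of star-algebras\<close>

lemma (in abelian_group) minus_eq_zero_iff:
  assumes "x \<in> carrier G" "y \<in> carrier G" shows "x \<ominus> y = \<zero> \<longleftrightarrow> x = y"
  using assms minus_equality[of x "\<ominus> y"] by (auto simp: minus_eq r_neg)

context star_algebra
begin

lemmas star_closed = cscale_closed adj_closed

lemma cscale_zero_left: "a \<in> carrier A \<Longrightarrow> cscale A 0 a = \<zero>"
  using add_cscale[of a 0 0] cscale_closed[of a 0] by (simp add: add.r_cancel_one')

lemma cscale_zero_right: "cscale A c \<zero> = \<zero>"
  using cscale_cscale[of \<zero> c 0] cscale_zero_left[of \<zero>] by simp

lemma cscale_minus_one: "a \<in> carrier A \<Longrightarrow> cscale A (-1) a = \<ominus> a"
  using add_cscale[of a "-1" 1] cscale_closed[of a "-1"]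
  by (simp add: cscale_zero_left cscale_one minus_equality)

lemma cscale_minus_left: "a \<in> carrier A \<Longrightarrow> cscale A (- c) a = \<ominus> cscale A c a"
  using cscale_cscale[of a "-1" c] cscale_minus_one[of "cscale A c a"] by (simp add: cscale_closed)

lemma cscale_minus_right: "a \<in> carrier A \<Longrightarrow> cscale A c (\<ominus> a) = \<ominus> cscale A c a"
  using cscale_cscale[of a c "-1"] by (simp add: cscale_minus_one cscale_minus_left[symmetric])

lemma adj_zero: "adj A \<zero> = \<zero>"
  using adj_cscale[of \<zero> 0] by (simp add: cscale_zero_left adj_closed)

lemma adj_one: "adj A \<one> = \<one>"
  using adj_mult[of "adj A \<one>" \<one>] by (simp add: adj_adj adj_closed)

lemma adj_minus: "a \<in> carrier A \<Longrightarrow> adj A (\<ominus> a) = \<ominus> adj A a"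
  using adj_cscale[of a "-1"] by (simp add: cscale_minus_one adj_closed)

lemma abs_sq_closed: "a \<in> carrier A \<Longrightarrow> abs_sq A a \<in> carrier A"
  by (simp add: abs_sq_def adj_closed)

lemma adj_abs_sq: "a \<in> carrier A \<Longrightarrow> adj A (abs_sq A a) = abs_sq A a"
  by (simp add: abs_sq_def adj_closed adj_mult adj_adj)

context
  fixes d
  assumes d: "hermitian_derivation A d"
begin

lemma derivation_closed: "a \<in> carrier A \<Longrightarrow> d a \<in> carrier A"
  using d by (auto simp: hermitian_derivation_def)

lemma derivation_add: "\<lbrakk>a \<in> carrier A; b \<in> carrier A\<rbrakk> \<Longrightarrow> d (a \<oplus> b) = d a \<oplus> d b"
  using d by (auto simp: hermitian_derivation_def)

lemma derivation_cscale: "a \<in> carrier A \<Longrightarrow> d (cscale A c a) = cscale A c (d a)"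
  using d by (auto simp: hermitian_derivation_def)

lemma derivation_mult:
  "\<lbrakk>a \<in> carrier A; b \<in> carrier A\<rbrakk> \<Longrightarrow> d (a \<otimes> b) = d a \<otimes> b \<oplus> a \<otimes> d b"
  using d by (auto simp: hermitian_derivation_def)

lemma derivation_adj: "a \<in> carrier A \<Longrightarrow> d (adj A a) = adj A (d a)"
  using d by (auto simp: hermitian_derivation_def)

lemma derivation_zero: "d \<zero> = \<zero>"
  using derivation_cscale[of \<zero> 0] by (simp add: cscale_zero_left derivation_closed)

lemma derivation_minus: "a \<in> carrier A \<Longrightarrow> d (\<ominus> a) = \<ominus> d a"
  using derivation_cscale[of a "-1"] by (simp add: cscale_minus_one derivation_closed)

lemma derivation_one: "d \<one> = \<zero>"
  using derivation_mult[of \<one> \<one>] by (simp add: derivation_closed add.r_cancel_one')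

text \<open>Differentiating \<open>b a = 1\<close> leaves \<open>d b a = 0\<close>, and right
  multiplication by \<open>b\<close> removes \<open>a\<close>. This controls derivations on the
  inverses that a localization adjoins.\<close>

lemma derivation_inverse_eq_zero:
  assumes "a \<in> carrier A" "b \<in> carrier A" "a \<otimes> b = \<one>" "b \<otimes> a = \<one>" "d a = \<zero>"
  shows "d b = \<zero>"
proof -
  have "d b \<otimes> a = \<zero>"
    using derivation_mult[of b a] assms by (simp add: derivation_one derivation_closed)
  then have "d b \<otimes> (a \<otimes> b) = \<zero>"
    using assms(1,2) by (simp add: m_assoc[symmetric] derivation_closed)
  then show ?thesis
    using assms(2,3) by (simp add: derivation_closed)
qed

end

text \<open>The mixed products \<open>d a \<otimes> e b\<close> and \<open>e a \<otimes> d b\<close>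
  occur in both orders of application and cancel. As a consequence, the vanishing of a bracket can
  be tested on generators.\<close>

lemma hermitian_derivation_der_bracket:
  assumes d: "hermitian_derivation A d" and e: "hermitian_derivation A e"
  shows "hermitian_derivation A (der_bracket A d e)"
  unfolding hermitian_derivation_def
proof (intro conjI ballI allI)
  note [simp] = star_closed derivation_closed[OF d] derivation_closed[OF e]
    derivation_add[OF d] derivation_add[OF e] derivation_cscale[OF d] derivation_cscale[OF e]
    derivation_mult[OF d] derivation_mult[OF e] derivation_adj[OF d] derivation_adj[OF e]
  show "der_bracket A d e \<in> carrier A \<rightarrow>\<^sub>E carrier A"
    by (auto simp: der_bracket_def)
  fix a assume a: "a \<in> carrier A"
  show "der_bracket A d e (cscale A c a) = cscale A c (der_bracket A d e a)" for c
    using a by (simp add: der_bracket_def minus_eq cscale_add cscale_minus_right)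
  show "der_bracket A d e (adj A a) = adj A (der_bracket A d e a)"
    using a by (simp add: der_bracket_def minus_eq adj_add adj_minus)
  fix b assume b: "b \<in> carrier A"
  show "der_bracket A d e (a \<oplus> b) = der_bracket A d e a \<oplus> der_bracket A d e b"
    using a b by (simp add: der_bracket_def minus_eq minus_add a_ac)
  have cancel: "s \<oplus> x \<ominus> (s \<oplus> y) = x \<ominus> y"
    if "s \<in> carrier A" "x \<in> carrier A" "y \<in> carrier A" for s x y
    using that a_comm[of s x] by (simp add: minus_eq minus_add a_assoc r_neg2)
  \<comment> \<open>Both iterated derivatives are written with the same mixed sum in front, which is
    the form that \<open>cancel\<close> strips.\<close>
  have "d (e (a \<otimes> b)) \<ominus> e (d (a \<otimes> b)) =
      (e a \<otimes> d b \<oplus> d a \<otimes> e b) \<oplus> (d (e a) \<otimes> b \<oplus> a \<otimes> d (e b)) \<ominus>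
      ((e a \<otimes> d b \<oplus> d a \<otimes> e b) \<oplus> (e (d a) \<otimes> b \<oplus> a \<otimes> e (d b)))"
    using a b by (simp add: a_ac)
  then show "der_bracket A d e (a \<otimes> b) =
      der_bracket A d e a \<otimes> b \<oplus> a \<otimes> der_bracket A d e b"
    using a b
    by (simp add: der_bracket_def cancel)
      (simp add: minus_eq minus_add l_distr r_distr l_minus r_minus a_ac)
qed

end

lemma star_alg_homD:
  assumes "f \<in> star_alg_hom A B"
  shows "f \<in> ring_hom A B"
    and "a \<in> carrier A \<Longrightarrow> f (adj A a) = adj B (f a)"
    and "a \<in> carrier A \<Longrightarrow> f (cscale A c a) = cscale B c (f a)"
  using assms by (auto simp: star_alg_hom_def)

text \<open>Every element is the class of a formal expression, and the kernel of a hermitian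
  derivation is closed under all term constructors, the star included because \<open>d\<close>
  commutes with \<open>adj\<close>.\<close>

lemma presented_derivation_eq_zero:
  assumes d: "hermitian_derivation (presented R) d"
    and gens: "\<And>g. d (cls R (SGen g)) = \<zero>\<^bsub>presented R\<^esub>"
    and a: "a \<in> carrier (presented R)"
  shows "d a = \<zero>\<^bsub>presented R\<^esub>"
proof -
  interpret star_algebra "presented R" by (rule presented_star_algebra)
  note der = derivation_zero[OF d] derivation_one[OF d] derivation_add[OF d] derivation_mult[OF d]
    derivation_cscale[OF d] derivation_adj[OF d]
  have cl: "cls R t \<in> carrier (presented R)" for t by (simp add: presented_simps)
  have "d (cls R t) = \<zero>\<^bsub>presented R\<^esub>" for t
    by (induction t)
      (simp_all only: gens presented_simps(2-7)[of R, symmetric] der cl adj_zero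
        cscale_zero_right r_zero l_null r_null zero_closed)
  with a show ?thesis by (auto simp: presented_simps(1))
qed

text \<open>The elements commuting with \<open>x\<close> form a subalgebra. It is closed under the
  star because \<open>x\<close> is self-adjoint, so checking the unstarred generators is
  enough.\<close>

lemma presented_central:
  assumes x: "x \<in> carrier (presented R)" "adj (presented R) x = x"
    and gens: "\<And>g. x \<otimes>\<^bsub>presented R\<^esub> cls R (SGen g) = cls R (SGen g) \<otimes>\<^bsub>presented R\<^esub> x"
    and a: "a \<in> carrier (presented R)"
  shows "x \<otimes>\<^bsub>presented R\<^esub> a = a \<otimes>\<^bsub>presented R\<^esub> x"
proof -
  interpret star_algebra "presented R" by (rule presented_star_algebra)
  have cl: "cls R t \<in> carrier (presented R)" for t by (simp add: presented_simps)
  have "x \<otimes>\<^bsub>presented R\<^esub> cls R t = cls R t \<otimes>\<^bsub>presented R\<^esub> x" for t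
  proof (induction t)
    case (SMul s t)
    then show ?case
      using x cl by (metis m_assoc presented_simps(4))
  next
    case (SStar t)
    then show ?case
      using adj_mult[OF x(1) cl[of t]] adj_mult[OF cl[of t] x(1)]
      by (simp add: x(2) presented_simps(7)[symmetric])
  qed (simp_all only: gens presented_simps(2-7)[of R, symmetric] cl x l_null r_null l_one r_one
        r_distr l_distr cscale_mult_left cscale_mult_right)
  with a show ?thesis by (auto simp: presented_simps(1))
qed

section \<open>Right modules\<close>

text \<open>The record \<open>rmodule\<close> fixes only operations. This locale supplies the laws
  of a unital right module over a ring that may be noncommutative.\<close>

locale right_module = R: ring A + abelian_group M
  for A :: "('a, 'c) star_algebra_scheme" and M :: "('a, 'm) rmodule" (structure) +
  assumes ract_closed: "\<lbrakk>m \<in> carrier M; a \<in> carrier A\<rbrakk> \<Longrightarrow> ract M m a \<in> carrier M"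
    and ract_add_left:
      "\<lbrakk>m \<in> carrier M; n \<in> carrier M; a \<in> carrier A\<rbrakk>
        \<Longrightarrow> ract M (m \<oplus> n) a = ract M m a \<oplus> ract M n a"
    and ract_add_right:
      "\<lbrakk>m \<in> carrier M; a \<in> carrier A; b \<in> carrier A\<rbrakk>
        \<Longrightarrow> ract M m (a \<oplus>\<^bsub>A\<^esub> b) = ract M m a \<oplus> ract M m b"
    and ract_ract:
      "\<lbrakk>m \<in> carrier M; a \<in> carrier A; b \<in> carrier A\<rbrakk>
        \<Longrightarrow> ract M (ract M m a) b = ract M m (a \<otimes>\<^bsub>A\<^esub> b)"
    and ract_one: "m \<in> carrier M \<Longrightarrow> ract M m \<one>\<^bsub>A\<^esub> = m"
begin

lemma ract_zero_right: "m \<in> carrier M \<Longrightarrow> ract M m \<zero>\<^bsub>A\<^esub> = \<zero>"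
  using ract_add_right[of m "\<zero>\<^bsub>A\<^esub>" "\<zero>\<^bsub>A\<^esub>"] ract_closed[of m "\<zero>\<^bsub>A\<^esub>"] by (simp add: add.r_cancel_one')

lemma ract_zero_left: "a \<in> carrier A \<Longrightarrow> ract M \<zero> a = \<zero>"
  using ract_add_left[of \<zero> \<zero> a] ract_closed[of \<zero> a] by (simp add: add.r_cancel_one')

lemma ract_finsum:
  assumes "a \<in> carrier A" "f \<in> I \<rightarrow> carrier M"
  shows "ract M (\<Oplus>i\<in>I. f i) a = (\<Oplus>i\<in>I. ract M (f i) a)"
  using assms(2)
proof (induction I rule: infinite_finite_induct)
  case (insert i I)
  then show ?case
    using assms(1) by (simp add: Pi_iff ract_add_left ract_closed)
qed (simp_all add: ract_zero_left assms(1))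

section \<open>Linear combinations of a finite family and the submodule it generates\<close>

context
  fixes I :: "nat set" and E :: "nat \<Rightarrow> 'm"
  assumes I: "finite I" and E: "E \<in> I \<rightarrow> carrier M"
begin

lemma family_closed: "i \<in> I \<Longrightarrow> E i \<in> carrier M"
  using E by blast

lemma ract_family: "c \<in> I \<rightarrow> carrier A \<Longrightarrow> (\<lambda>i. ract M (E i) (c i)) \<in> I \<rightarrow> carrier M"
  using E by (auto intro: ract_closed)

lemma lincomb_closed: "c \<in> I \<rightarrow> carrier A \<Longrightarrow> lincomb M I E c \<in> carrier M"
  unfolding lincomb_def by (intro finsum_closed ract_family)

lemma lincomb_cong:
  assumes "b \<in> I \<rightarrow> carrier A" "\<And>i. i \<in> I \<Longrightarrow> a i = b i"
  shows "lincomb M I E a = lincomb M I E b"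
  unfolding lincomb_def by (rule finsum_cong') (simp_all add: assms(2) ract_family[OF assms(1)])

lemma lincomb_add:
  assumes "a \<in> I \<rightarrow> carrier A" "b \<in> I \<rightarrow> carrier A"
  shows "lincomb M I E a \<oplus> lincomb M I E b = lincomb M I E (\<lambda>i. a i \<oplus>\<^bsub>A\<^esub> b i)"
proof -
  have "lincomb M I E (\<lambda>i. a i \<oplus>\<^bsub>A\<^esub> b i) =
      (\<Oplus>i\<in>I. ract M (E i) (a i) \<oplus> ract M (E i) (b i))"
    unfolding lincomb_def using assms E
    by (intro finsum_cong') (auto intro!: ract_closed ract_add_right add.m_closed)
  then show ?thesis
    by (simp add: lincomb_def finsum_addf ract_family assms)
qed

lemma lincomb_ract:
  assumes "c \<in> I \<rightarrow> carrier A" "a \<in> carrier A"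
  shows "ract M (lincomb M I E c) a = lincomb M I E (\<lambda>i. c i \<otimes>\<^bsub>A\<^esub> a)"
proof -
  have "ract M (lincomb M I E c) a = (\<Oplus>i\<in>I. ract M (ract M (E i) (c i)) a)"
    by (simp add: lincomb_def ract_finsum ract_family assms)
  also have "\<dots> = lincomb M I E (\<lambda>i. c i \<otimes>\<^bsub>A\<^esub> a)"
    unfolding lincomb_def using assms E
    by (intro finsum_cong') (auto intro!: ract_closed ract_ract)
  finally show ?thesis .
qed

lemma lincomb_zero: "lincomb M I E (\<lambda>_. \<zero>\<^bsub>A\<^esub>) = \<zero>"
  unfolding lincomb_def
  by (intro add.finprod_one_eqI) (simp add: ract_zero_right family_closed)

lemma lincomb_single:
  assumes "i \<in> I" "a \<in> carrier A"
  shows "lincomb M I E (\<lambda>j. if i = j then a else \<zero>\<^bsub>A\<^esub>) = ract M (E i) a"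
proof -
  have "lincomb M I E (\<lambda>j. if i = j then a else \<zero>\<^bsub>A\<^esub>) =
      (\<Oplus>j\<in>I. if i = j then ract M (E j) a else \<zero>)"
    unfolding lincomb_def using assms
    by (intro finsum_cong') (auto simp: ract_zero_right family_closed ract_closed)
  also have "\<dots> = ract M (E i) a"
    using assms I by (intro finsum_singleton) (auto simp: ract_closed family_closed)
  finally show ?thesis .
qed

lemma carrier_generated_submodule:
  "carrier (generated_submodule A M I E) = lincomb M I E ` (I \<rightarrow> carrier A)"
  by (simp add: generated_submodule_def)

lemma generated_submodule_subset: "carrier (generated_submodule A M I E) \<subseteq> carrier M"
  by (auto simp: carrier_generated_submodule lincomb_closed)

lemma basis_in_generated_submodule:
  assumes "i \<in> I" shows "E i \<in> carrier (generated_submodule A M I E)"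
proof -
  have "lincomb M I E (\<lambda>j. if i = j then \<one>\<^bsub>A\<^esub> else \<zero>\<^bsub>A\<^esub>) \<in> lincomb M I E ` (I \<rightarrow> carrier A)"
    by (rule imageI) auto
  then show ?thesis
    using assms by (simp add: carrier_generated_submodule lincomb_single ract_one family_closed)
qed

lemma right_module_generated_submodule: "right_module A (generated_submodule A M I E)"
proof -
  let ?N = "generated_submodule A M I E"
  have ops: "add ?N = add M" "zero ?N = zero M" "ract ?N = ract M"
    by (simp_all add: generated_submodule_def)
  have sub: "m \<in> carrier M" if "m \<in> carrier ?N" for m
    using that generated_submodule_subset by blast
  have cl: "m \<oplus> n \<in> carrier ?N" if "m \<in> carrier ?N" "n \<in> carrier ?N" for m n
  proof -
    obtain a b where a: "a \<in> I \<rightarrow> carrier A" "m = lincomb M I E a"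
      and b: "b \<in> I \<rightarrow> carrier A" "n = lincomb M I E b"
      using \<open>m \<in> carrier ?N\<close> \<open>n \<in> carrier ?N\<close> by (auto simp: carrier_generated_submodule)
    show ?thesis
      unfolding carrier_generated_submodule a(2) b(2) lincomb_add[OF a(1) b(1)]
      by (rule imageI) (use a b in auto)
  qed
  have ract_cl: "ract M m a \<in> carrier ?N" if "m \<in> carrier ?N" "a \<in> carrier A" for m a
  proof -
    obtain c where c: "c \<in> I \<rightarrow> carrier A" "m = lincomb M I E c"
      using \<open>m \<in> carrier ?N\<close> by (auto simp: carrier_generated_submodule)
    show ?thesis
      unfolding carrier_generated_submodule c(2) lincomb_ract[OF c(1) that(2)]
      by (rule imageI) (use c that(2) in auto)
  qed
  have zero: "\<zero> \<in> carrier ?N"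
    unfolding carrier_generated_submodule using imageI[of "\<lambda>_. \<zero>\<^bsub>A\<^esub>" "I \<rightarrow> carrier A" "lincomb M I E"]
    by (simp add: lincomb_zero)
  \<comment> \<open>Acting by \<open>-1\<close> produces the additive inverse, so closure under
    \<open>ract\<close> already yields it.\<close>
  have inv: "\<exists>n\<in>carrier ?N. n \<oplus> m = \<zero>" if "m \<in> carrier ?N" for m
  proof
    show "ract M m (\<ominus>\<^bsub>A\<^esub> \<one>\<^bsub>A\<^esub>) \<in> carrier ?N" using that by (intro ract_cl) auto
    show "ract M m (\<ominus>\<^bsub>A\<^esub> \<one>\<^bsub>A\<^esub>) \<oplus> m = \<zero>"
      using ract_add_right[OF sub[OF that], of "\<ominus>\<^bsub>A\<^esub> \<one>\<^bsub>A\<^esub>" "\<one>\<^bsub>A\<^esub>"]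
      by (simp add: R.l_neg ract_one ract_zero_right sub that)
  qed
  have "abelian_group ?N"
    by (rule abelian_groupI) (simp_all add: ops cl zero inv a_assoc sub, simp add: a_comm sub)
  then show ?thesis
    by (intro right_module.intro right_module_axioms.intro R.ring_axioms)
      (simp_all add: ops ract_cl ract_add_left ract_add_right ract_ract ract_one sub)
qed

text \<open>A \<open>finsum\<close> refers to the carrier of its record as well as to its
  operations, so sums in the submodule are compared with ambient sums by induction on the index
  set.\<close>

lemma finsum_generated_submodule:
  assumes "f \<in> J \<rightarrow> carrier (generated_submodule A M I E)"
  shows "(\<Oplus>\<^bsub>generated_submodule A M I E\<^esub>j\<in>J. f j) = (\<Oplus>j\<in>J. f j)"
proof -
  interpret N: right_module A "generated_submodule A M I E"
    by (rule right_module_generated_submodule)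
  have ops: "add (generated_submodule A M I E) = add M"
    "zero (generated_submodule A M I E) = zero M"
    by (simp_all add: generated_submodule_def)
  from assms show ?thesis
  proof (induction J rule: infinite_finite_induct)
    case (insert j J)
    then have "f \<in> insert j J \<rightarrow> carrier M"
      using generated_submodule_subset by blast
    with insert show ?case by (simp add: ops(1) Pi_iff)
  qed (simp_all add: ops(2))
qed

text \<open>The generated submodule is described by combinations formed in the ambient module; this
  restates them in terms of the submodule itself, so that spanning becomes an intrinsic
  statement.\<close>

lemma lincomb_generated_submodule:
  assumes "J \<subseteq> I" "c \<in> J \<rightarrow> carrier A"
  shows "lincomb (generated_submodule A M I E) J E c = lincomb M J E c"
proof -
  interpret N: right_module A "generated_submodule A M I E"
    by (rule right_module_generated_submodule)
  have ops: "ract (generated_submodule A M I E) = ract M"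
    by (simp add: generated_submodule_def)
  have "(\<lambda>i. ract M (E i) (c i)) \<in> J \<rightarrow> carrier (generated_submodule A M I E)"
  proof
    fix i assume "i \<in> J"
    then have "E i \<in> carrier (generated_submodule A M I E)" "c i \<in> carrier A"
      using assms basis_in_generated_submodule by blast+
    then show "ract M (E i) (c i) \<in> carrier (generated_submodule A M I E)"
      using N.ract_closed by (simp add: ops)
  qed
  then show ?thesis
    by (simp add: lincomb_def ops finsum_generated_submodule)
qed

end

text \<open>Splitting off one index later separates the normal direction from the tangent
  ones.\<close>

lemma lincomb_insert:
  assumes "finite I" "x \<notin> I" "E \<in> insert x I \<rightarrow> carrier M" "c \<in> insert x I \<rightarrow> carrier A"
  shows "lincomb M (insert x I) E c = ract M (E x) (c x) \<oplus> lincomb M I E c"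
  unfolding lincomb_def using assms by (intro finsum_insert) (auto intro!: ract_closed)

end

lemma right_module_free_rmodule:
  assumes "ring A" shows "right_module A (free_rmodule A n)"
proof -
  interpret R: ring A by (rule assms)
  \<comment> \<open>Vectors are lists of length \<open>n\<close>, so the module laws are checked
    entry by entry.\<close>
  have eq: "v = w \<longleftrightarrow> (\<forall>i<n. v ! i = w ! i)" if "length v = n" "length w = n" for v w :: "'a list"
    using that by (auto intro: nth_equalityI)
  have mem: "v \<in> carrier (free_rmodule A n) \<longleftrightarrow> length v = n \<and> (\<forall>i<n. v ! i \<in> carrier A)" for v
    by (auto simp: free_rmodule_def set_conv_nth)
  have zero: "zero (free_rmodule A n) = replicate n \<zero>\<^bsub>A\<^esub>"
    and add: "add (free_rmodule A n) = map2 (add A)"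
    and ract: "ract (free_rmodule A n) = (\<lambda>v a. map (\<lambda>x. x \<otimes>\<^bsub>A\<^esub> a) v)"
    by (simp_all add: free_rmodule_def)
  have "abelian_group (free_rmodule A n)"
  proof (rule abelian_groupI)
    fix v assume v: "v \<in> carrier (free_rmodule A n)"
    then have "map (a_inv A) v \<oplus>\<^bsub>free_rmodule A n\<^esub> v = \<zero>\<^bsub>free_rmodule A n\<^esub>"
      by (subst eq) (auto simp: mem zero add R.l_neg)
    with v show "\<exists>w\<in>carrier (free_rmodule A n). w \<oplus>\<^bsub>free_rmodule A n\<^esub> v = \<zero>\<^bsub>free_rmodule A n\<^esub>"
      by (intro bexI[of _ "map (a_inv A) v"]) (auto simp: mem)
  qed (simp_all add: mem zero add eq R.a_assoc, simp add: R.a_comm)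
  then show ?thesis
    by (intro right_module.intro right_module_axioms.intro assms)
      (auto simp: mem add ract eq R.l_distr R.r_distr R.m_assoc in_set_conv_nth)
qed

section \<open>Orthogonal frames and hypersurfaces\<close>

lemma (in ring) Units_l_eq_zero:
  assumes "u \<in> Units R" "a \<in> carrier R" "u \<otimes> a = \<zero>" shows "a = \<zero>"
  using Units_l_cancel[OF assms(1,2) zero_closed] assms by (simp add: Units_closed)

text \<open>In row \<open>i\<close> of \<open>K N = 1\<close> only the term \<open>k = i\<close>
  survives, and the unit \<open>K i i\<close> cancels from the left.\<close>

lemma (in ring) inverse_matrix_diagonal:
  assumes inv: "inverse_matrix R I K N" and I: "finite I" "i \<in> I" "j \<in> I"
    and off: "\<And>i j. \<lbrakk>i \<in> I; j \<in> I; i \<noteq> j\<rbrakk> \<Longrightarrow> K i j = \<zero>"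
    and unit: "K i i \<in> Units R"
  shows "N i j = (if i = j then inv (K i i) else \<zero>)"
proof -
  have N: "N k l \<in> carrier R" if "k \<in> I" "l \<in> I" for k l
    using inv that by (simp add: inverse_matrix_def)
  have "(\<Oplus>k\<in>I. K i k \<otimes> N k j) = (\<Oplus>k\<in>I. if i = k then K i i \<otimes> N k j else \<zero>)"
    using I Units_closed[OF unit] off N by (intro finsum_cong') auto
  also have "\<dots> = K i i \<otimes> N i j"
    using I Units_closed[OF unit] N by (intro finsum_singleton) auto
  finally have eq: "K i i \<otimes> N i j = (if i = j then \<one> else \<zero>)"
    using inv I by (simp add: inverse_matrix_def)
  have "N i j = inv (K i i) \<otimes> (K i i \<otimes> N i j)"
    using unit N[OF I(2,3)] Units_closed[OF unit] by (simp add: m_assoc[symmetric])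
  also have "\<dots> = (if i = j then inv (K i i) else \<zero>)"
    unfolding eq using unit by (cases "i = j") simp_all
  finally show ?thesis .
qed

lemma (in star_algebra) adj_finsum:
  assumes "f \<in> I \<rightarrow> carrier A" shows "adj A (\<Oplus>i\<in>I. f i) = (\<Oplus>i\<in>I. adj A (f i))"
  using assms
proof (induction I rule: infinite_finite_induct)
  case (insert i I)
  then show ?case by (simp add: Pi_iff adj_add adj_closed)
qed (simp_all add: adj_zero)

section \<open>Hermitian forms and the Koszul formula\<close>

locale hermitian_module = star_algebra A + M: right_module A M
  for A :: "'a star_algebra" (structure) and M :: "('a, 'm) rmodule" +
  fixes h :: "'m \<Rightarrow> 'm \<Rightarrow> 'a"
  assumes hermitian: "hermitian_form A M h"
begin

lemma form_closed: "\<lbrakk>m \<in> carrier M; n \<in> carrier M\<rbrakk> \<Longrightarrow> h m n \<in> carrier A"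
  using hermitian by (simp add: hermitian_form_def)

lemma form_add_right:
  "\<lbrakk>m \<in> carrier M; n \<in> carrier M; p \<in> carrier M\<rbrakk> \<Longrightarrow> h m (n \<oplus>\<^bsub>M\<^esub> p) = h m n \<oplus> h m p"
  using hermitian by (simp add: hermitian_form_def)

lemma form_ract_right:
  "\<lbrakk>m \<in> carrier M; n \<in> carrier M; a \<in> carrier A\<rbrakk> \<Longrightarrow> h m (ract M n a) = h m n \<otimes> a"
  using hermitian by (simp add: hermitian_form_def)

lemma adj_form: "\<lbrakk>m \<in> carrier M; n \<in> carrier M\<rbrakk> \<Longrightarrow> adj A (h m n) = h n m"
  using hermitian by (simp add: hermitian_form_def)

lemma form_ract_left:
  assumes "m \<in> carrier M" "n \<in> carrier M" "a \<in> carrier A"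
  shows "h (ract M m a) n = adj A a \<otimes> h m n"
proof -
  have "h (ract M m a) n = adj A (h n (ract M m a))"
    using assms by (simp add: adj_form M.ract_closed)
  then show ?thesis
    using assms by (simp add: form_ract_right adj_mult form_closed adj_form)
qed

lemma form_eq_zero_sym:
  "\<lbrakk>m \<in> carrier M; n \<in> carrier M; h m n = \<zero>\<rbrakk> \<Longrightarrow> h n m = \<zero>"
  using adj_form[of m n] by (simp add: adj_zero)

text \<open>
  The Koszul formula for commuting \<open>d\<close>, \<open>e\<close> with orthogonal images: torsion-freeness turns
  \<open>h (nab d (\<phi> e)) (\<phi> d)\<close> into \<open>h (nab e (\<phi> d)) (\<phi> d)\<close>, which is hermitian and therefore half of
  \<open>e (h (\<phi> d) (\<phi> d))\<close>.
\<close>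

lemma levi_civita_commuting_orthogonal:
  fixes d e :: "'a \<Rightarrow> 'a"
  assumes nab: "levi_civita C h nab"
    and C: "rc_alg C = A" "rc_mod C = M"
    and g: "d \<in> rc_lie C" "e \<in> rc_lie C"
    and der: "hermitian_derivation A d" "hermitian_derivation A e"
    and map: "rc_map C d \<in> carrier M" "rc_map C e \<in> carrier M"
      "rc_map C (der_bracket A d e) = \<zero>\<^bsub>M\<^esub>"
    and orth: "h (rc_map C e) (rc_map C d) = \<zero>"
  shows "h (rc_map C e) (nab d (rc_map C d)) =
    cscale A (- 1 / 2) (e (h (rc_map C d) (rc_map C d)))"
proof -
  let ?D = "rc_map C d" and ?E = "rc_map C e"
  have cl: "nab f m \<in> carrier M" if "f \<in> rc_lie C" "m \<in> carrier M" for f m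
    using nab C that by (simp add: levi_civita_def Let_def affine_connection_def)
  have compat: "f (h m n) = h (nab f m) n \<oplus> h m (nab f n)"
    if "f \<in> rc_lie C" "m \<in> carrier M" "n \<in> carrier M" for f m n
    using nab C that by (simp add: levi_civita_def Let_def)
  have "\<forall>d\<in>rc_lie C. \<forall>e\<in>rc_lie C. nab d (rc_map C e) \<ominus>\<^bsub>M\<^esub> nab e (rc_map C d) \<ominus>\<^bsub>M\<^esub>
      rc_map C (der_bracket A d e) = \<zero>\<^bsub>M\<^esub>"
    using nab by (simp add: levi_civita_def Let_def C)
  then have "nab d ?E \<ominus>\<^bsub>M\<^esub> nab e ?D \<ominus>\<^bsub>M\<^esub> \<zero>\<^bsub>M\<^esub> = \<zero>\<^bsub>M\<^esub>"
    using g map(3) by metis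
  then have torsion: "nab d ?E = nab e ?D"
    using cl g map M.minus_eq_zero_iff M.minus_closed by simp
  define s where "s = h (nab e ?D) ?D"
  have s: "s \<in> carrier A" "h ?D (nab e ?D) = s"
  proof -
    show "s \<in> carrier A"
      using cl g map by (simp add: s_def form_closed)
    have "adj A s = s"
      using nab C g by (simp add: s_def levi_civita_def Let_def)
    then show "h ?D (nab e ?D) = s"
      using cl g map adj_form[of "nab e ?D" ?D] by (simp add: s_def)
  qed
  have "e (h ?D ?D) = s \<oplus> s"
    using compat[OF g(2) map(1) map(1)] by (simp add: s s_def[symmetric])
  also have "\<dots> = cscale A 2 s"
    using add_cscale[of s 1 1] s(1) by (simp add: cscale_one)
  finally have "cscale A (- 1 / 2) (e (h ?D ?D)) = \<ominus> s"
    using s(1) by (simp add: cscale_cscale cscale_minus_one)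
  \<comment> \<open>This differentiates \<open>h ?E ?D = 0\<close> along \<open>d\<close>;
    torsion-freeness replaces \<open>nab d ?E\<close> by \<open>nab e ?D\<close>, so the first
    Leibniz term is \<open>s\<close>.\<close>
  moreover have "\<zero> = s \<oplus> h ?E (nab d ?D)"
    using compat[OF g(1) map(2) map(1)]
    by (simp add: orth derivation_zero[OF der(1)] torsion s_def)
  ultimately show ?thesis
    using minus_equality[of "h ?E (nab d ?D)" s] s(1) cl g map
    by (metis form_closed a_comm minus_equality)
qed

end

text \<open>Pairing a combination with \<open>E i\<close> returns its \<open>i\<close>-th
  coefficient multiplied by the unit \<open>K i i\<close>. Hence \<open>spanning\<close> and
  \<open>diagonal\<close> together make the frame a basis.\<close>

locale orthogonal_frame = star_algebra A + M: right_module A M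
  for A :: "'a star_algebra" (structure) and M :: "('a, 'm) rmodule" +
  fixes I :: "nat set" and E :: "nat \<Rightarrow> 'm" and K :: "nat \<Rightarrow> nat \<Rightarrow> 'a"
    and h :: "'m \<Rightarrow> 'm \<Rightarrow> 'a"
  assumes finite: "finite I"
    and frame_closed: "E \<in> I \<rightarrow> carrier M"
    and spanning: "carrier M = lincomb M I E ` (I \<rightarrow> carrier A)"
    and form: "matrix_form A M I E K h"
    and off_diagonal: "\<lbrakk>i \<in> I; j \<in> I; i \<noteq> j\<rbrakk> \<Longrightarrow> K i j = \<zero>"
    and diagonal: "i \<in> I \<Longrightarrow> K i i \<in> Units A" "i \<in> I \<Longrightarrow> adj A (K i i) = K i i"
begin

lemma diagonal_closed: "i \<in> I \<Longrightarrow> K i i \<in> carrier A"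
  using diagonal(1) by (rule Units_closed)

lemma form_lincomb:
  assumes "m \<in> I \<rightarrow> carrier A" "n \<in> I \<rightarrow> carrier A"
  shows "h (lincomb M I E m) (lincomb M I E n) = (\<Oplus>i\<in>I. adj A (m i) \<otimes> K i i \<otimes> n i)"
proof -
  have cl: "m i \<in> carrier A" "n i \<in> carrier A" "adj A (m i) \<in> carrier A" if "i \<in> I" for i
    using assms that by (auto intro: adj_closed)
  have "(\<Oplus>j\<in>I. adj A (m i) \<otimes> K i j \<otimes> n j) = adj A (m i) \<otimes> K i i \<otimes> n i" if i: "i \<in> I" for i
  proof -
    have "(\<Oplus>j\<in>I. adj A (m i) \<otimes> K i j \<otimes> n j) =
        (\<Oplus>j\<in>I. if i = j then adj A (m i) \<otimes> K i i \<otimes> n j else \<zero>)"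
      using i by (intro finsum_cong') (auto simp: cl off_diagonal diagonal_closed)
    also have "\<dots> = adj A (m i) \<otimes> K i i \<otimes> n i"
      using i finite by (intro finsum_singleton) (auto simp: cl diagonal_closed)
    finally show ?thesis .
  qed
  then have "(\<Oplus>i\<in>I. \<Oplus>j\<in>I. adj A (m i) \<otimes> K i j \<otimes> n j) =
      (\<Oplus>i\<in>I. adj A (m i) \<otimes> K i i \<otimes> n i)"
    by (intro finsum_cong') (auto simp: cl diagonal_closed)
  with form assms show ?thesis by (simp add: matrix_form_def)
qed

text \<open>\<open>matrix_form\<close> prescribes \<open>h\<close> on combinations of the frame, and
  by \<open>spanning\<close> these are all vectors. Hermitian symmetry comes from the
  self-adjointness of the diagonal entries.\<close>

sublocale hermitian_module A M h
proof
  have lc: "\<exists>c \<in> I \<rightarrow> carrier A. m = lincomb M I E c" if "m \<in> carrier M" for m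
    using that spanning by auto
  note lincomb_add' = M.lincomb_add[OF finite frame_closed]
    and lincomb_ract' = M.lincomb_ract[OF finite frame_closed]
  have terms: "(\<lambda>i. adj A (m i) \<otimes> K i i \<otimes> n i) \<in> I \<rightarrow> carrier A"
    if "m \<in> I \<rightarrow> carrier A" "n \<in> I \<rightarrow> carrier A" for m n
    using that by (auto intro!: m_closed adj_closed diagonal_closed)
  show "hermitian_form A M h"
    unfolding hermitian_form_def
  proof (intro conjI ballI)
    fix m n assume "m \<in> carrier M" "n \<in> carrier M"
    then obtain a b where a: "a \<in> I \<rightarrow> carrier A" "m = lincomb M I E a"
      and b: "b \<in> I \<rightarrow> carrier A" "n = lincomb M I E b"
      using lc by meson
    have cl: "a i \<in> carrier A" "b i \<in> carrier A" if "i \<in> I" for i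
      using a b that by auto
    show "h m n \<in> carrier A"
      by (simp add: a(2) b(2) form_lincomb[OF a(1) b(1)] finsum_closed terms a b)
    have "adj A (h m n) = (\<Oplus>i\<in>I. adj A (adj A (a i) \<otimes> K i i \<otimes> b i))"
      by (simp add: a(2) b(2) form_lincomb[OF a(1) b(1)] adj_finsum terms a b)
    also have "\<dots> = h n m"
      unfolding a(2) b(2) form_lincomb[OF b(1) a(1)]
      by (intro finsum_cong')
        (auto simp: cl adj_mult adj_adj adj_closed diagonal diagonal_closed m_assoc terms a b)
    finally show "adj A (h m n) = h n m" .
    show "h m (ract M n x) = h m n \<otimes> x" if x: "x \<in> carrier A" for x
    proof -
      have bx: "(\<lambda>i. b i \<otimes> x) \<in> I \<rightarrow> carrier A" using b x by auto
      have "h m n \<otimes> x = (\<Oplus>i\<in>I. adj A (a i) \<otimes> K i i \<otimes> b i \<otimes> x)"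
        unfolding a(2) b(2) form_lincomb[OF a(1) b(1)]
        by (intro finsum_ldistr finite x terms a b)
      also have "\<dots> = h m (ract M n x)"
        unfolding a(2) b(2) lincomb_ract'[OF b(1) x] form_lincomb[OF a(1) bx]
        by (intro finsum_cong') (auto simp: cl x adj_closed diagonal_closed m_assoc)
      finally show ?thesis ..
    qed
    show "h m (n \<oplus>\<^bsub>M\<^esub> p) = h m n \<oplus> h m p" if p: "p \<in> carrier M" for p
    proof -
      obtain c where c: "c \<in> I \<rightarrow> carrier A" "p = lincomb M I E c"
        using lc[OF p] by blast
      have bc: "(\<lambda>i. b i \<oplus> c i) \<in> I \<rightarrow> carrier A" using b c by auto
      have cl': "c i \<in> carrier A" if "i \<in> I" for i using c that by auto
      have "h m (n \<oplus>\<^bsub>M\<^esub> p) =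
          (\<Oplus>i\<in>I. adj A (a i) \<otimes> K i i \<otimes> b i \<oplus> adj A (a i) \<otimes> K i i \<otimes> c i)"
        unfolding a(2) b(2) c(2) lincomb_add'[OF b(1) c(1)] form_lincomb[OF a(1) bc]
        by (intro finsum_cong') (auto simp: cl cl' adj_closed diagonal_closed r_distr)
      then show ?thesis
        unfolding a(2) b(2) c(2) form_lincomb[OF a(1) b(1)] form_lincomb[OF a(1) c(1)]
        by (simp add: finsum_addf terms a b c)
    qed
  qed
qed

text \<open>Writing \<open>E i\<close> with Kronecker coefficients leaves one term of the diagonal
  sum. This is how coefficients are read off from the form.\<close>

lemma form_frame_lincomb:
  assumes "i \<in> I" "n \<in> I \<rightarrow> carrier A"
  shows "h (E i) (lincomb M I E n) = K i i \<otimes> n i"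
proof -
  let ?\<delta> = "\<lambda>j. if i = j then \<one> else \<zero>"
  have "h (E i) (lincomb M I E n) = h (lincomb M I E ?\<delta>) (lincomb M I E n)"
    using assms M.lincomb_single[OF finite frame_closed assms(1) one_closed]
    by (simp add: M.ract_one M.family_closed[OF finite frame_closed])
  also have "\<dots> = (\<Oplus>j\<in>I. adj A (?\<delta> j) \<otimes> K j j \<otimes> n j)"
    using assms by (intro form_lincomb) auto
  also have "\<dots> = (\<Oplus>j\<in>I. if i = j then K j j \<otimes> n j else \<zero>)"
    using assms by (intro finsum_cong') (auto simp: adj_one adj_zero diagonal_closed Pi_iff)
  also have "\<dots> = K i i \<otimes> n i"
    using assms finite by (intro finsum_singleton) (auto simp: diagonal_closed)
  finally show ?thesis .
qed

lemma form_frame: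
  assumes "i \<in> I" "j \<in> I" shows "h (E i) (E j) = (if i = j then K i i else \<zero>)"
proof -
  have "h (E i) (lincomb M I E (\<lambda>k. if j = k then \<one> else \<zero>)) =
      K i i \<otimes> (if j = i then \<one> else \<zero>)"
    using assms by (intro form_frame_lincomb) auto
  then show ?thesis
    using assms M.lincomb_single[OF finite frame_closed assms(2) one_closed]
    by (auto simp: M.ract_one M.family_closed[OF finite frame_closed] diagonal_closed)
qed

end

text \<open>\<open>J\<close> indexes the tangent directions and \<open>x\<close> the normal one.\<close>

locale orthogonal_hypersurface = orthogonal_frame A M "insert x J" E K h
  for A :: "'a star_algebra" (structure) and M :: "('a, 'm) rmodule" and x J E K h +
  assumes normal_notin: "x \<notin> J"
begin

abbreviation "tangent \<equiv> generated_submodule A M J E"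

lemma finite_tangent: "finite J" and tangent_frame: "E \<in> J \<rightarrow> carrier M"
  using finite frame_closed by auto

lemmas frame = M.family_closed[OF finite frame_closed]

lemma normal_closed: "E x \<in> carrier M"
  by (simp add: frame)

lemma tangent_closed: "n \<in> carrier tangent \<Longrightarrow> n \<in> carrier M"
  using M.generated_submodule_subset[OF finite_tangent tangent_frame] by blast

lemma form_normal_tangent:
  assumes "n \<in> carrier tangent" shows "h (E x) n = \<zero>"
proof -
  obtain c where c: "c \<in> J \<rightarrow> carrier A" "n = lincomb M J E c"
    using assms by (auto simp: generated_submodule_def)
  \<comment> \<open>Extension by zero at \<open>x\<close> turns a tangent combination into one over
    the full frame whose normal coefficient vanishes.\<close>
  let ?c = "\<lambda>i. if i = x then \<zero> else c i"
  have c': "?c \<in> insert x J \<rightarrow> carrier A" using c by auto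
  have "lincomb M J E ?c = n"
    unfolding c(2) using normal_notin
    by (intro M.lincomb_cong[OF finite_tangent tangent_frame c(1)]) auto
  then have "n = lincomb M (insert x J) E ?c"
    using M.lincomb_insert[OF finite_tangent normal_notin frame_closed c'] tangent_closed[OF assms]
    by (simp add: M.ract_zero_right normal_closed)
  then show ?thesis
    using form_frame_lincomb[OF _ c'] by (simp add: diagonal_closed)
qed

lemma tangent_normal_decomposition:
  assumes "m \<in> carrier M"
  obtains n c where "n \<in> carrier tangent" "c \<in> carrier A" "m = n \<oplus>\<^bsub>M\<^esub> ract M (E x) c"
proof -
  obtain c where c: "c \<in> insert x J \<rightarrow> carrier A" "m = lincomb M (insert x J) E c"
    using assms spanning by auto
  have n: "lincomb M J E c \<in> carrier tangent"
    using c by (auto simp: generated_submodule_def)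
  have cx: "c x \<in> carrier A" using c by auto
  have "m = lincomb M J E c \<oplus>\<^bsub>M\<^esub> ract M (E x) (c x)"
    unfolding c(2) M.lincomb_insert[OF finite_tangent normal_notin frame_closed c(1)]
    by (rule M.a_comm) (simp_all add: M.ract_closed normal_closed cx tangent_closed[OF n])
  with n cx show ?thesis by (rule that)
qed

text \<open>For a vector with coefficients \<open>c\<close>, orthogonality to \<open>E j\<close>
  amounts to \<open>K j j \<otimes> c j = \<zero>\<close>. The unit \<open>K j j\<close> forces
  \<open>c j = \<zero>\<close>, and only the normal term is left.\<close>

lemma orth_compl_tangent: "orth_compl A M h tangent = ract M (E x) ` carrier A"
proof (intro equalityI subsetI)
  fix m assume "m \<in> ract M (E x) ` carrier A"
  then obtain c where c: "c \<in> carrier A" "m = ract M (E x) c" by auto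
  show "m \<in> orth_compl A M h tangent"
    using c by (auto simp: orth_compl_def M.ract_closed normal_closed form_ract_left tangent_closed
        form_normal_tangent adj_closed)
next
  fix m assume m: "m \<in> orth_compl A M h tangent"
  then have mM: "m \<in> carrier M" by (simp add: orth_compl_def)
  then obtain c where c: "c \<in> insert x J \<rightarrow> carrier A" "m = lincomb M (insert x J) E c"
    using spanning by auto
  have "c j = \<zero>" if j: "j \<in> J" for j
  proof -
    have "h m (E j) = \<zero>"
      using m M.basis_in_generated_submodule[OF finite_tangent tangent_frame j]
      by (simp add: orth_compl_def)
    then have "K j j \<otimes> c j = \<zero>"
      using form_frame_lincomb[OF _ c(1), of j] form_eq_zero_sym[OF mM] j frame
      by (simp add: c(2))
    then show ?thesis
      using c(1) j diagonal(1)[of j] Units_l_eq_zero[of "K j j" "c j"] by auto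
  qed
  then have "lincomb M J E c = \<zero>\<^bsub>M\<^esub>"
    using M.lincomb_cong[OF finite_tangent tangent_frame, of "\<lambda>_. \<zero>" c]
    by (simp add: M.lincomb_zero[OF finite_tangent tangent_frame])
  then have "m = ract M (E x) (c x)"
    using c(1) unfolding c(2) M.lincomb_insert[OF finite_tangent normal_notin frame_closed c(1)]
    by (simp add: M.ract_closed normal_closed Pi_iff)
  then show "m \<in> ract M (E x) ` carrier A" using c(1) by auto
qed

text \<open>The definite description in \<open>normal_proj\<close> requires uniqueness: pairing with
  \<open>E x\<close> kills the tangent part and gives \<open>K x x \<otimes> c\<close>, from which
  the unit cancels.\<close>

lemma normal_proj_eq:
  assumes n: "n \<in> carrier tangent" and c: "c \<in> carrier A"
  shows "normal_proj A M h tangent (n \<oplus>\<^bsub>M\<^esub> ract M (E x) c) = ract M (E x) c"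
  unfolding normal_proj_def orth_compl_tangent
proof (rule the_equality)
  have h_normal: "h (E x) (n \<oplus>\<^bsub>M\<^esub> ract M (E x) c) = K x x \<otimes> c"
    if "n \<in> carrier tangent" "c \<in> carrier A" for n c
    using that
    by (simp add: form_add_right form_ract_right form_normal_tangent form_frame M.ract_closed
        normal_closed tangent_closed diagonal_closed)
  fix p
  assume "p \<in> ract M (E x) ` carrier A \<and>
    (\<exists>n'\<in>carrier tangent. n \<oplus>\<^bsub>M\<^esub> ract M (E x) c = n' \<oplus>\<^bsub>M\<^esub> p)"
  then obtain n' c' where c': "c' \<in> carrier A" "p = ract M (E x) c'"
    and n': "n' \<in> carrier tangent" "n \<oplus>\<^bsub>M\<^esub> ract M (E x) c = n' \<oplus>\<^bsub>M\<^esub> p"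
    by auto
  then have "K x x \<otimes> c = K x x \<otimes> c'"
    using h_normal[OF n c] h_normal[OF n'(1) c'(1)] by simp
  then have "c = c'"
    using Units_l_cancel[OF diagonal(1)] c c' by simp
  with c' show "p = ract M (E x) c" by simp
qed (use n c in auto)

lemma form_normal_proj:
  assumes "m \<in> carrier M" "c \<in> carrier A"
  shows "h (ract M (E x) c) (normal_proj A M h tangent m) = adj A c \<otimes> h (E x) m"
proof -
  from assms(1) obtain n b where nb: "n \<in> carrier tangent" "b \<in> carrier A"
    "m = n \<oplus>\<^bsub>M\<^esub> ract M (E x) b"
    by (rule tangent_normal_decomposition)
  show ?thesis
    unfolding nb(3) normal_proj_eq[OF nb(1,2)]
    using nb assms
    by (simp add: form_ract_left form_add_right form_normal_tangent M.ract_closed normal_closed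
        tangent_closed form_closed)
qed

text \<open>A diagonal \<open>N\<close> collapses the double sum. The coefficient \<open>c\<close>
  leaves the first argument of \<open>h\<close> as an adjoint on the left and therefore factors out
  of the whole sum.\<close>

lemma mean_curvature_normal:
  assumes B: "star_algebra B" and \<phi>: "\<phi> \<in> star_alg_hom A B"
    and C: "rc_alg C = A" "rc_mod C = M"
    and nab: "\<And>i j. \<lbrakk>i \<in> J; j \<in> J\<rbrakk> \<Longrightarrow> nab (\<psi> (\<delta> i)) (rc_map C (\<psi> (\<delta> j))) \<in> carrier M"
    and N: "\<And>i. i \<in> J \<Longrightarrow> N i i \<in> carrier B"
      "\<And>i j. \<lbrakk>i \<in> J; j \<in> J; i \<noteq> j\<rbrakk> \<Longrightarrow> N i j = \<zero>\<^bsub>B\<^esub>"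
    and c: "c \<in> carrier A"
  shows "mean_curvature C h nab tangent B J \<delta> N \<phi> \<psi> (ract M (E x) c) =
    adj B (\<phi> c) \<otimes>\<^bsub>B\<^esub>
      (\<Oplus>\<^bsub>B\<^esub>i\<in>J. \<phi> (h (E x) (nab (\<psi> (\<delta> i)) (rc_map C (\<psi> (\<delta> i))))) \<otimes>\<^bsub>B\<^esub> N i i)"
proof -
  interpret B: star_algebra B by (rule B)
  note \<phi>D = star_alg_homD[OF \<phi>]
  define t where "t i j = \<phi> (h (E x) (nab (\<psi> (\<delta> i)) (rc_map C (\<psi> (\<delta> j)))))" for i j
  have t: "t i j \<in> carrier B" if "i \<in> J" "j \<in> J" for i j
    using ring_hom_closed[OF \<phi>D(1)] nab[OF that] by (simp add: t_def form_closed normal_closed)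
  have c': "adj B (\<phi> c) \<in> carrier B"
    using ring_hom_closed[OF \<phi>D(1) c] by (rule B.adj_closed)
  have term_eq: "\<phi> (h (ract M (E x) c) (second_fundamental_form C h nab tangent \<psi> (\<delta> i)
      (rc_map C (\<psi> (\<delta> j))))) = adj B (\<phi> c) \<otimes>\<^bsub>B\<^esub> t i j" if "i \<in> J" "j \<in> J" for i j
    using nab[OF that] c
    by (simp add: second_fundamental_form_def C form_normal_proj t_def ring_hom_mult[OF \<phi>D(1)]
        \<phi>D(2) adj_closed form_closed normal_closed)
  have "(\<Oplus>\<^bsub>B\<^esub>j\<in>J. \<phi> (h (ract M (E x) c) (second_fundamental_form C h nab tangent \<psi> (\<delta> i)
      (rc_map C (\<psi> (\<delta> j))))) \<otimes>\<^bsub>B\<^esub> N i j) = adj B (\<phi> c) \<otimes>\<^bsub>B\<^esub> (t i i \<otimes>\<^bsub>B\<^esub> N i i)"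
    if i: "i \<in> J" for i
  proof -
    have "(\<Oplus>\<^bsub>B\<^esub>j\<in>J. \<phi> (h (ract M (E x) c) (second_fundamental_form C h nab tangent \<psi> (\<delta> i)
        (rc_map C (\<psi> (\<delta> j))))) \<otimes>\<^bsub>B\<^esub> N i j) =
        (\<Oplus>\<^bsub>B\<^esub>j\<in>J. if i = j then adj B (\<phi> c) \<otimes>\<^bsub>B\<^esub> (t j j \<otimes>\<^bsub>B\<^esub> N j j) else \<zero>\<^bsub>B\<^esub>)"
      using i t c' N by (intro B.finsum_cong') (auto simp: term_eq B.m_assoc)
    also have "\<dots> = adj B (\<phi> c) \<otimes>\<^bsub>B\<^esub> (t i i \<otimes>\<^bsub>B\<^esub> N i i)"
      using i t c' N finite_tangent by (intro B.finsum_singleton) auto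
    finally show ?thesis .
  qed
  then have "mean_curvature C h nab tangent B J \<delta> N \<phi> \<psi> (ract M (E x) c) =
      (\<Oplus>\<^bsub>B\<^esub>i\<in>J. adj B (\<phi> c) \<otimes>\<^bsub>B\<^esub> (t i i \<otimes>\<^bsub>B\<^esub> N i i))"
    unfolding mean_curvature_def using t c' N by (intro B.finsum_cong') auto
  also have "\<dots> = adj B (\<phi> c) \<otimes>\<^bsub>B\<^esub> (\<Oplus>\<^bsub>B\<^esub>i\<in>J. t i i \<otimes>\<^bsub>B\<^esub> N i i)"
    using t c' N finite_tangent by (intro B.finsum_rdistr[symmetric]) auto
  finally show ?thesis by (simp add: t_def)
qed

text \<open>The mean curvature of each normal vector is a left multiple of one fixed sum, and the
  normal vector with \<open>c = \<one>\<close> recovers that sum.\<close>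

lemma minimal_embedding_iff:
  assumes B: "star_algebra B" and \<phi>: "\<phi> \<in> star_alg_hom A B"
    and C: "rc_alg C = A" "rc_mod C = M"
    and nab: "\<And>i j. \<lbrakk>i \<in> J; j \<in> J\<rbrakk> \<Longrightarrow> nab (\<psi> (\<delta> i)) (rc_map C (\<psi> (\<delta> j))) \<in> carrier M"
    and N: "\<And>i. i \<in> J \<Longrightarrow> N i i \<in> carrier B"
      "\<And>i j. \<lbrakk>i \<in> J; j \<in> J; i \<noteq> j\<rbrakk> \<Longrightarrow> N i j = \<zero>\<^bsub>B\<^esub>"
  shows "minimal_embedding C h nab tangent B J \<delta> N \<phi> \<psi> \<longleftrightarrow>
    (\<Oplus>\<^bsub>B\<^esub>i\<in>J. \<phi> (h (E x) (nab (\<psi> (\<delta> i)) (rc_map C (\<psi> (\<delta> i))))) \<otimes>\<^bsub>B\<^esub> N i i) = \<zero>\<^bsub>B\<^esub>"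
    (is "_ \<longleftrightarrow> ?S = _")
proof -
  interpret B: star_algebra B by (rule B)
  note hom = star_alg_homD(1)[OF \<phi>]
  have "(\<lambda>i. \<phi> (h (E x) (nab (\<psi> (\<delta> i)) (rc_map C (\<psi> (\<delta> i))))) \<otimes>\<^bsub>B\<^esub> N i i) \<in> J \<rightarrow> carrier B"
    using ring_hom_closed[OF hom] nab N by (auto simp: form_closed normal_closed)
  then have S: "?S \<in> carrier B" by (rule B.finsum_closed)
  have "minimal_embedding C h nab tangent B J \<delta> N \<phi> \<psi> \<longleftrightarrow>
      (\<forall>c\<in>carrier A. adj B (\<phi> c) \<otimes>\<^bsub>B\<^esub> ?S = \<zero>\<^bsub>B\<^esub>)"
    unfolding minimal_embedding_def C orth_compl_tangent
    using mean_curvature_normal[of B \<phi> C nab \<psi> \<delta> N, OF B \<phi> C nab N] by simp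
  also have "\<dots> \<longleftrightarrow> ?S = \<zero>\<^bsub>B\<^esub>"
  proof
    assume "\<forall>c\<in>carrier A. adj B (\<phi> c) \<otimes>\<^bsub>B\<^esub> ?S = \<zero>\<^bsub>B\<^esub>"
    then have "adj B (\<phi> \<one>) \<otimes>\<^bsub>B\<^esub> ?S = \<zero>\<^bsub>B\<^esub>" by blast
    then show "?S = \<zero>\<^bsub>B\<^esub>"
      using S by (simp add: ring_hom_one[OF hom] B.adj_one)
  qed (use ring_hom_closed[OF hom] B.adj_closed in auto)
  finally show ?thesis .
qed

end

section \<open>The localized noncommutative 3-sphere\<close>

text \<open>The star-algebra laws are stable under renaming generators, so only the relations have
  to be checked.\<close>

lemma pres_eq_map_sterm:
  assumes "pres_eq R s t"
    and "\<And>s t. (s, t) \<in> R \<Longrightarrow> pres_eq S (map_sterm f s) (map_sterm f t)"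
  shows "pres_eq S (map_sterm f s) (map_sterm f t)"
  using assms(1)
proof induction
  case (rel s t)
  then show ?case by (rule assms(2))
qed (auto intro: pres_eq.intros)

interpretation S3: star_algebra "S3 \<theta>" for \<theta>
  unfolding S3_def by (rule presented_star_algebra)

interpretation S3loc: star_algebra "S3loc \<theta>" for \<theta>
  unfolding S3loc_def by (rule presented_star_algebra)

interpretation T2: star_algebra "T2 \<theta>" for \<theta>
  unfolding T2_def by (rule presented_star_algebra)

text \<open>The renamed relations of the sphere are among those of the localization. All
  representatives of a class thus have the same image, and the union defining \<open>to_loc\<close>
  is a single class.\<close>

lemma to_loc_cls:
  "to_loc \<theta> (cls (s3_rels \<theta>) t) = cls (s3loc_rels \<theta>) (map_sterm Base t)"
  unfolding to_loc_def
proof (rule cls_lift1)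
  fix x assume "pres_eq (s3_rels \<theta>) t x"
  then have "pres_eq (s3_rels \<theta>) x t" by (rule pres_eq.sym)
  then show "cls (s3loc_rels \<theta>) (map_sterm Base x) = cls (s3loc_rels \<theta>) (map_sterm Base t)"
    unfolding cls_eq_iff
    by (rule pres_eq_map_sterm) (rule pres_eq.rel, force simp: s3loc_rels_def Let_def)
qed

lemma to_loc_closed: "H \<in> carrier (S3 \<theta>) \<Longrightarrow> to_loc \<theta> H \<in> carrier (S3loc \<theta>)"
  by (auto simp: S3_def S3loc_def presented_simps to_loc_cls)

lemma to_loc_abs_sq:
  "H \<in> carrier (S3 \<theta>) \<Longrightarrow> to_loc \<theta> (abs_sq (S3 \<theta>) H) = abs_sq (S3loc \<theta>) (to_loc \<theta> H)"
  by (auto simp: S3_def S3loc_def abs_sq_def presented_simps to_loc_cls)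

lemma qpar_cnj: "qpar \<theta> * cnj (qpar \<theta>) = 1"
proof -
  have "cmod (qpar \<theta>) = 1" by (simp add: qpar_def norm_exp_eq_Re)
  then show ?thesis by (simp add: complex_norm_square[symmetric])
qed

section \<open>Relations and central elements of the localized sphere\<close>

context
  fixes \<theta> :: real
begin

private abbreviation (input) "A \<equiv> S3loc \<theta>"
private abbreviation (input) "Z \<equiv> Zel \<theta>"
private abbreviation (input) "W \<equiv> Wel \<theta>"
private abbreviation (input) "z \<equiv> abs_sq (S3loc \<theta>) (Zel \<theta>)"
private abbreviation (input) "w \<equiv> abs_sq (S3loc \<theta>) (Wel \<theta>)"

lemma Zel_closed: "Z \<in> carrier A" and Wel_closed: "W \<in> carrier A"
  by (simp_all add: Zel_def Wel_def S3loc_def presented_simps)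

lemma S3loc_rels:
  "W \<otimes>\<^bsub>A\<^esub> Z = cscale A (qpar \<theta>) (Z \<otimes>\<^bsub>A\<^esub> W)"
  "W \<otimes>\<^bsub>A\<^esub> adj A Z = cscale A (cnj (qpar \<theta>)) (adj A Z \<otimes>\<^bsub>A\<^esub> W)"
  "adj A Z \<otimes>\<^bsub>A\<^esub> Z = Z \<otimes>\<^bsub>A\<^esub> adj A Z"
  "W \<otimes>\<^bsub>A\<^esub> adj A W = \<one>\<^bsub>A\<^esub> \<oplus>\<^bsub>A\<^esub> cscale A (-1) (Z \<otimes>\<^bsub>A\<^esub> adj A Z)"
  by (simp_all add: S3loc_def Zel_def Wel_def presented_simps cls_eq_iff,
      (rule pres_eq.rel, simp add: s3loc_rels_def s3_rels_def Let_def)+)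

lemma abs_sq_Wel: "w = \<one>\<^bsub>A\<^esub> \<ominus>\<^bsub>A\<^esub> z"
  by (simp add: abs_sq_def S3loc_rels(4) S3loc.cscale_minus_one S3loc.minus_eq Zel_closed S3loc.adj_closed)

lemma abs_sq_gens_closed: "z \<in> carrier A" "w \<in> carrier A"
  by (simp_all add: S3loc.abs_sq_closed Zel_closed Wel_closed)

lemma abs_sq_Zel_commutes_Zel: "z \<otimes>\<^bsub>A\<^esub> Z = Z \<otimes>\<^bsub>A\<^esub> z"
  by (simp add: abs_sq_def S3loc.m_assoc S3loc_rels(3) Zel_closed S3loc.adj_closed)

text \<open>Moving \<open>W\<close> past \<open>Z\<close> costs the factor
  \<open>qpar \<theta>\<close>, and moving it past \<open>adj A Z\<close> costs the conjugate; their
  product is 1.\<close>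

lemma abs_sq_Zel_commutes_Wel: "z \<otimes>\<^bsub>A\<^esub> W = W \<otimes>\<^bsub>A\<^esub> z"
proof -
  note [simp] = Zel_closed Wel_closed S3loc.star_closed S3loc.cscale_mult_left S3loc.cscale_mult_right
  have "W \<otimes>\<^bsub>A\<^esub> z = (W \<otimes>\<^bsub>A\<^esub> Z) \<otimes>\<^bsub>A\<^esub> adj A Z"
    by (simp add: abs_sq_def S3loc.m_assoc)
  also have "\<dots> = cscale A (qpar \<theta>) (Z \<otimes>\<^bsub>A\<^esub> (W \<otimes>\<^bsub>A\<^esub> adj A Z))"
    by (simp add: S3loc_rels(1) S3loc.m_assoc)
  also have "\<dots> = z \<otimes>\<^bsub>A\<^esub> W"
    by (simp add: S3loc_rels(2) S3loc.cscale_cscale qpar_cnj S3loc.cscale_one abs_sq_def S3loc.m_assoc)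
  finally show ?thesis ..
qed

private abbreviation (input) "iz \<equiv> cls (s3loc_rels \<theta>) (SGen InvZ)"
private abbreviation (input) "iw \<equiv> cls (s3loc_rels \<theta>) (SGen InvW)"

lemma abs_sq_inverses:
  "iz \<in> carrier A" "iz \<otimes>\<^bsub>A\<^esub> z = \<one>\<^bsub>A\<^esub>" "z \<otimes>\<^bsub>A\<^esub> iz = \<one>\<^bsub>A\<^esub>"
  "iw \<in> carrier A" "iw \<otimes>\<^bsub>A\<^esub> w = \<one>\<^bsub>A\<^esub>" "w \<otimes>\<^bsub>A\<^esub> iw = \<one>\<^bsub>A\<^esub>"
  by (simp_all add: S3loc_def Zel_def Wel_def abs_sq_def presented_simps rangeI cls_eq_iff,
      (rule pres_eq.rel, simp add: s3loc_rels_def Let_def)+)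

lemma abs_sq_Units: "z \<in> Units A" "w \<in> Units A"
  using abs_sq_inverses abs_sq_gens_closed by (auto simp: Units_def)

text \<open>Since \<open>z\<close> is self-adjoint, the four generators suffice. \<open>InvZ\<close>
  is the inverse of \<open>z\<close>, and \<open>InvW\<close> is the inverse of
  \<open>w = 1 - z\<close>, which commutes with \<open>z\<close>.\<close>

lemma abs_sq_Zel_central:
  assumes "a \<in> carrier A" shows "z \<otimes>\<^bsub>A\<^esub> a = a \<otimes>\<^bsub>A\<^esub> z"
proof -
  note inv = abs_sq_inverses and cl = abs_sq_gens_closed
  let ?iw = "cls (s3loc_rels \<theta>) (SGen InvW)"
  have zw: "z \<otimes>\<^bsub>A\<^esub> w = w \<otimes>\<^bsub>A\<^esub> z"
    unfolding abs_sq_Wel using cl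
    by (simp add: S3loc.minus_eq S3loc.l_distr S3loc.r_distr S3loc.l_minus S3loc.r_minus)
  \<comment> \<open>With \<open>iw\<close> the inverse of \<open>w\<close>, the chain is
    \<open>z iw = iw w z iw = iw z w iw = iw z\<close>.\<close>
  have "z \<otimes>\<^bsub>A\<^esub> ?iw = ?iw \<otimes>\<^bsub>A\<^esub> (w \<otimes>\<^bsub>A\<^esub> z) \<otimes>\<^bsub>A\<^esub> ?iw"
    using inv cl by (simp add: S3loc.m_assoc[symmetric])
  also have "\<dots> = ?iw \<otimes>\<^bsub>A\<^esub> z"
    unfolding zw[symmetric] using inv cl by (simp add: S3loc.m_assoc)
  finally have "z \<otimes>\<^bsub>A\<^esub> cls (s3loc_rels \<theta>) (SGen g) = cls (s3loc_rels \<theta>) (SGen g) \<otimes>\<^bsub>A\<^esub> z" for g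
    using abs_sq_Zel_commutes_Zel abs_sq_Zel_commutes_Wel inv
    \<comment> \<open>The case expression names the sphere generator under \<open>Base\<close>, so
      that the second split separates \<open>GenZ\<close> from \<open>GenW\<close>.\<close>
    by (cases g rule: s3loc_gen.exhaust; (cases "case g of Base b \<Rightarrow> b" rule: s3_gen.exhaust)?)
      (simp_all add: Zel_def Wel_def)
  then show ?thesis
    using presented_central[of z "s3loc_rels \<theta>" a] cl S3loc.adj_abs_sq[OF Zel_closed] assms
    by (simp add: S3loc_def)
qed

lemma abs_sq_Wel_central:
  assumes "a \<in> carrier A" shows "w \<otimes>\<^bsub>A\<^esub> a = a \<otimes>\<^bsub>A\<^esub> w"
  unfolding abs_sq_Wel using assms abs_sq_Zel_central[OF assms] abs_sq_gens_closed(1)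
  by (simp add: S3loc.minus_eq S3loc.l_distr S3loc.r_distr S3loc.l_minus S3loc.r_minus)

text \<open>A hermitian derivation killing \<open>Z\<close> and \<open>W\<close> kills
  \<open>z\<close> and \<open>w\<close>, hence their adjoined inverses, and so every generator of
  the localization.\<close>

lemma S3loc_derivation_eq_zero:
  assumes d: "hermitian_derivation A d" and gens: "d Z = \<zero>\<^bsub>A\<^esub>" "d W = \<zero>\<^bsub>A\<^esub>"
    and a: "a \<in> carrier A"
  shows "d a = \<zero>\<^bsub>A\<^esub>"
proof -
  have "d z = \<zero>\<^bsub>A\<^esub>" "d w = \<zero>\<^bsub>A\<^esub>"
    using Zel_closed Wel_closed
    by (simp_all add: abs_sq_def S3loc.derivation_mult[OF d] S3loc.derivation_adj[OF d] gens S3loc.adj_closed S3loc.adj_zero)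
  then have "d (cls (s3loc_rels \<theta>) (SGen InvZ)) = \<zero>\<^bsub>A\<^esub>" "d (cls (s3loc_rels \<theta>) (SGen InvW)) = \<zero>\<^bsub>A\<^esub>"
    using S3loc.derivation_inverse_eq_zero[OF d] abs_sq_inverses abs_sq_gens_closed by meson+
  then have "d (cls (s3loc_rels \<theta>) (SGen g)) = \<zero>\<^bsub>A\<^esub>" for g
    using gens s3_gen.exhaust unfolding Zel_def Wel_def by (cases g) metis+
  then show ?thesis
    using presented_derivation_eq_zero[of "s3loc_rels \<theta>" d a] d a by (simp add: S3loc_def)
qed

lemma derivation_abs_sq_Wel:
  assumes e: "hermitian_derivation A e" shows "e w = \<ominus>\<^bsub>A\<^esub> e z"
  unfolding abs_sq_Wel using abs_sq_gens_closed
  by (simp add: S3loc.minus_eq S3loc.derivation_add[OF e] S3loc.derivation_minus[OF e] S3loc.derivation_one[OF e]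
      S3loc.derivation_closed[OF e])

lemma derivation_abs_sq_Zel:
  assumes e: "hermitian_derivation A e"
  shows "e z = e Z \<otimes>\<^bsub>A\<^esub> adj A Z \<oplus>\<^bsub>A\<^esub> Z \<otimes>\<^bsub>A\<^esub> adj A (e Z)"
  using Zel_closed by (simp add: abs_sq_def S3loc.derivation_mult[OF e] S3loc.derivation_adj[OF e] S3loc.adj_closed)

section \<open>The derivations of the sphere\<close>

context
  fixes d :: "nat \<Rightarrow> s3loc \<Rightarrow> s3loc"
  assumes d: "s3_derivations \<theta> d"
begin

lemma hermitian_s3_derivations:
  "hermitian_derivation A (d 1)" "hermitian_derivation A (d 2)" "hermitian_derivation A (d 3)"
  using d by (simp_all add: s3_derivations_def Let_def)

lemma s3_derivations_gens:
  "d 1 Z = cscale A \<i> Z" "d 1 W = \<zero>\<^bsub>A\<^esub>"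
  "d 2 Z = \<zero>\<^bsub>A\<^esub>" "d 2 W = cscale A \<i> W"
  "d 3 Z = Z \<otimes>\<^bsub>A\<^esub> w" "d 3 W = \<ominus>\<^bsub>A\<^esub> (W \<otimes>\<^bsub>A\<^esub> z)"
  using d by (simp_all add: s3_derivations_def Let_def)

text \<open>For \<open>d 1\<close> the factors \<open>\<i>\<close> and \<open>cnj \<i>\<close>
  cancel. For \<open>d 3\<close> both Leibniz terms equal \<open>z w\<close>, because
  \<open>w\<close> is central and self-adjoint.\<close>

lemma s3_derivation_abs_sq:
  "d 1 z = \<zero>\<^bsub>A\<^esub>" "d 2 z = \<zero>\<^bsub>A\<^esub>" "d 3 z = cscale A 2 (z \<otimes>\<^bsub>A\<^esub> w)"
proof -
  note [simp] = Zel_closed Wel_closed abs_sq_gens_closed S3loc.star_closed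
  note herm = hermitian_s3_derivations and gens = s3_derivations_gens
  show "d 1 z = \<zero>\<^bsub>A\<^esub>"
    by (simp add: derivation_abs_sq_Zel[OF herm(1)] gens S3loc.adj_cscale S3loc.cscale_mult_left
        S3loc.cscale_mult_right S3loc.add_cscale[symmetric] S3loc.cscale_zero_left del: One_nat_def)
  show "d 2 z = \<zero>\<^bsub>A\<^esub>"
    by (simp add: derivation_abs_sq_Zel[OF herm(2)] gens S3loc.adj_zero)
  have "d 3 z = z \<otimes>\<^bsub>A\<^esub> w \<oplus>\<^bsub>A\<^esub> z \<otimes>\<^bsub>A\<^esub> w"
  proof -
    have "Z \<otimes>\<^bsub>A\<^esub> (w \<otimes>\<^bsub>A\<^esub> adj A Z) = z \<otimes>\<^bsub>A\<^esub> w"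
      by (simp add: abs_sq_Wel_central) (simp add: abs_sq_def[of _ Z] S3loc.m_assoc)
    then show ?thesis
      by (simp add: derivation_abs_sq_Zel[OF herm(3)] gens S3loc.adj_mult S3loc.adj_abs_sq S3loc.m_assoc)
  qed
  also have "\<dots> = cscale A 2 (z \<otimes>\<^bsub>A\<^esub> w)"
    using S3loc.add_cscale[of "z \<otimes>\<^bsub>A\<^esub> w" \<theta> 1 1] by (simp add: S3loc.cscale_one)
  finally show "d 3 z = cscale A 2 (z \<otimes>\<^bsub>A\<^esub> w)" .
qed

text \<open>The bracket is a hermitian derivation, so \<open>Z\<close> and \<open>W\<close> suffice.
  On them \<open>d 1\<close> and \<open>d 2\<close> act by constants, and both annihilate
  \<open>z\<close> and \<open>w\<close>, the coefficients appearing in \<open>d 3\<close>.\<close>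

lemma s3_derivations_commute:
  assumes i: "i \<in> {1, 2}" and a: "a \<in> carrier A"
  shows "der_bracket A (d i) (d 3) a = \<zero>\<^bsub>A\<^esub>"
proof (rule S3loc_derivation_eq_zero[OF S3loc.hermitian_derivation_der_bracket _ _ a])
  note [simp] = Zel_closed Wel_closed abs_sq_gens_closed S3loc.star_closed
  note herm = hermitian_s3_derivations and gens = s3_derivations_gens
  have w: "d 1 w = \<zero>\<^bsub>A\<^esub>" "d 2 w = \<zero>\<^bsub>A\<^esub>"
    by (simp_all add: derivation_abs_sq_Wel herm s3_derivation_abs_sq del: One_nat_def)
  note rules = der_bracket_def gens S3loc.derivation_mult[OF herm(1)] S3loc.derivation_mult[OF herm(2)]
    S3loc.derivation_minus[OF herm(1)] S3loc.derivation_minus[OF herm(2)] S3loc.derivation_cscale[OF herm(3)]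
    S3loc.derivation_zero[OF herm(3)] s3_derivation_abs_sq w S3loc.cscale_mult_left S3loc.cscale_minus_right
    S3loc.minus_eq S3loc.r_neg S3loc.l_neg
  show "der_bracket A (d i) (d 3) Z = \<zero>\<^bsub>A\<^esub>" using i by (auto simp: rules simp del: One_nat_def)
  show "der_bracket A (d i) (d 3) W = \<zero>\<^bsub>A\<^esub>" using i by (auto simp: rules simp del: One_nat_def)
qed (use i hermitian_s3_derivations in auto)

end

end

section \<open>The torus in the 3-sphere\<close>

lemma star_alg_hom_abs_sq:
  assumes "\<phi> \<in> star_alg_hom A B" "star_algebra A" "a \<in> carrier A"
  shows "\<phi> (abs_sq A a) = abs_sq B (\<phi> a)"
  using star_alg_homD[OF assms(1)] assms(2,3)
  by (simp add: abs_sq_def ring_hom_mult star_algebra.adj_closed)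

text \<open>This evaluates the images of \<open>z\<close> and \<open>w\<close> in the torus, where
  \<open>Z\<close> and \<open>W\<close> become scalar multiples of unitaries.\<close>

lemma (in star_algebra) abs_sq_cscale:
  assumes "a \<in> carrier A" "abs_sq A a = \<one>"
  shows "abs_sq A (cscale A c a) = cscale A (of_real ((cmod c)\<^sup>2)) \<one>"
  using assms
  by (simp add: abs_sq_def adj_cscale cscale_mult_left cscale_mult_right star_closed cscale_cscale
      complex_norm_square[symmetric] mult.commute[of "cnj c"])

lemma (in star_algebra) inv_cscale:
  assumes a: "a \<in> Units A" and c: "c \<noteq> 0"
  shows "cscale A c a \<in> Units A" "inv (cscale A c a) = cscale A (1 / c) (inv a)"
proof -
  have cl: "cscale A c a \<in> carrier A" "cscale A (1 / c) (inv a) \<in> carrier A"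
    using a by (auto intro: cscale_closed)
  have "cscale A c a \<otimes> cscale A (1 / c) (inv a) = \<one>" "cscale A (1 / c) (inv a) \<otimes> cscale A c a = \<one>"
    using a c
    by (simp_all add: cscale_mult_left cscale_mult_right cscale_closed cscale_cscale cscale_one
        Units_closed)
  with cl show "cscale A c a \<in> Units A" "inv (cscale A c a) = cscale A (1 / c) (inv a)"
    by (auto simp: Units_def intro: inv_char)
qed

lemma Uel_closed: "Uel \<theta> \<in> carrier (T2 \<theta>)" and Vel_closed: "Vel \<theta> \<in> carrier (T2 \<theta>)"
  by (simp_all add: Uel_def Vel_def T2_def presented_simps)

lemma abs_sq_torus_gens:
  "abs_sq (T2 \<theta>) (Uel \<theta>) = \<one>\<^bsub>T2 \<theta>\<^esub>" "abs_sq (T2 \<theta>) (Vel \<theta>) = \<one>\<^bsub>T2 \<theta>\<^esub>"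
  by (simp_all add: T2_def Uel_def Vel_def abs_sq_def presented_simps cls_eq_iff,
      (rule pres_eq.rel, simp add: t2_rels_def Let_def)+)

lemma ring_hom_Units:
  assumes "f \<in> ring_hom A B" "monoid A" "u \<in> Units A"
  shows "f u \<in> Units B"
proof -
  interpret monoid A by fact
  obtain v where "v \<in> carrier A" "v \<otimes>\<^bsub>A\<^esub> u = \<one>\<^bsub>A\<^esub>" "u \<otimes>\<^bsub>A\<^esub> v = \<one>\<^bsub>A\<^esub>"
    using assms(3) by (auto simp: Units_def)
  then show ?thesis
    using assms ring_hom_closed[OF assms(1)] ring_hom_mult[OF assms(1)] ring_hom_one[OF assms(1)]
    unfolding Units_def by (smt (verit) Units_closed mem_Collect_eq)
qed

section \<open>The frame of the sphere and its metric\<close>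

lemma s3_basis_closed: "s3_basis \<theta> \<in> {1, 2, 3} \<rightarrow> carrier (free_rmodule (S3loc \<theta>) 4)"
  by (auto simp: s3_basis_def free_rmodule_def Let_def re_part_def im_part_def S3loc.star_closed
      S3loc.abs_sq_closed Zel_closed Wel_closed)

lemma s3_module_right_module: "right_module (S3loc \<theta>) (s3_module \<theta>)"
  unfolding s3_module_def
  by (intro right_module.right_module_generated_submodule right_module_free_rmodule
      S3loc.ring_axioms s3_basis_closed) simp

lemma s3_module_spanning:
  "carrier (s3_module \<theta>) =
    lincomb (s3_module \<theta>) {1, 2, 3} (s3_basis \<theta>) ` ({1, 2, 3} \<rightarrow> carrier (S3loc \<theta>))"
proof -
  interpret F: right_module "S3loc \<theta>" "free_rmodule (S3loc \<theta>) 4"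
    by (rule right_module_free_rmodule) (rule S3loc.ring_axioms)
  have fin: "finite {1, 2, 3 :: nat}" by simp
  show ?thesis
    unfolding s3_module_def F.carrier_generated_submodule[OF fin s3_basis_closed]
    by (intro image_cong refl F.lincomb_generated_submodule[symmetric] s3_basis_closed) auto
qed

lemma s3_basis_in_s3_module: "s3_basis \<theta> \<in> {1, 2, 3} \<rightarrow> carrier (s3_module \<theta>)"
proof -
  interpret F: right_module "S3loc \<theta>" "free_rmodule (S3loc \<theta>) 4"
    by (rule right_module_free_rmodule) (rule S3loc.ring_axioms)
  show ?thesis
    unfolding s3_module_def
    by (intro Pi_I F.basis_in_generated_submodule s3_basis_closed) auto
qed

text \<open>The middle factor is central and moves to the left of \<open>G\<close>, which then meets
  its adjoint and forms \<open>k\<close>.\<close>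

lemma s3_metric_matrix_diagonal:
  fixes \<theta> G
  defines "z \<equiv> abs_sq (S3loc \<theta>) (Zel \<theta>)" and "w \<equiv> abs_sq (S3loc \<theta>) (Wel \<theta>)"
    and "k \<equiv> abs_sq (S3loc \<theta>) G"
  assumes G: "G \<in> carrier (S3loc \<theta>)"
  shows "s3_metric_matrix \<theta> G 1 1 = z \<otimes>\<^bsub>S3loc \<theta>\<^esub> k"
    and "s3_metric_matrix \<theta> G 2 2 = w \<otimes>\<^bsub>S3loc \<theta>\<^esub> k"
    and "s3_metric_matrix \<theta> G 3 3 = z \<otimes>\<^bsub>S3loc \<theta>\<^esub> w \<otimes>\<^bsub>S3loc \<theta>\<^esub> k"
proof -
  have cl: "z \<in> carrier (S3loc \<theta>)" "w \<in> carrier (S3loc \<theta>)"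
    by (simp_all add: z_def w_def abs_sq_gens_closed)
  have central: "G \<otimes>\<^bsub>S3loc \<theta>\<^esub> z = z \<otimes>\<^bsub>S3loc \<theta>\<^esub> G" "G \<otimes>\<^bsub>S3loc \<theta>\<^esub> w = w \<otimes>\<^bsub>S3loc \<theta>\<^esub> G"
    using G by (simp_all add: z_def w_def abs_sq_Zel_central abs_sq_Wel_central)
  have central2: "G \<otimes>\<^bsub>S3loc \<theta>\<^esub> (z \<otimes>\<^bsub>S3loc \<theta>\<^esub> w) = z \<otimes>\<^bsub>S3loc \<theta>\<^esub> w \<otimes>\<^bsub>S3loc \<theta>\<^esub> G"
    using G cl by (metis central S3loc.m_assoc)
  show "s3_metric_matrix \<theta> G 1 1 = z \<otimes>\<^bsub>S3loc \<theta>\<^esub> k" "s3_metric_matrix \<theta> G 2 2 = w \<otimes>\<^bsub>S3loc \<theta>\<^esub> k"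
    "s3_metric_matrix \<theta> G 3 3 = z \<otimes>\<^bsub>S3loc \<theta>\<^esub> w \<otimes>\<^bsub>S3loc \<theta>\<^esub> k"
    using G cl
    by (simp_all add: s3_metric_matrix_def Let_def central central2 S3loc.m_assoc S3loc.adj_closed
        k_def abs_sq_def[of _ G] flip: z_def w_def)
qed

theorem mainTheorem14:
  fixes \<theta> :: real
    and H :: "s3_gen sterm set"
    and lam mu :: complex
    and d :: "nat \<Rightarrow> s3loc \<Rightarrow> s3loc"
    and C :: "(s3loc, s3loc list) real_calculus"
    and h :: "s3loc list \<Rightarrow> s3loc list \<Rightarrow> s3loc"
    and nab :: "(s3loc \<Rightarrow> s3loc) \<Rightarrow> s3loc list \<Rightarrow> s3loc list"
    and \<delta> :: "nat \<Rightarrow> t2 \<Rightarrow> t2"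
    and C' :: "(t2, t2 list) real_calculus"
    and h' :: "t2 list \<Rightarrow> t2 list \<Rightarrow> t2"
    and hinv :: "nat \<Rightarrow> nat \<Rightarrow> t2"
    and phi :: "s3loc \<Rightarrow> t2"
    and psi :: "(t2 \<Rightarrow> t2) \<Rightarrow> s3loc \<Rightarrow> s3loc"
    and psihat :: "s3loc list \<Rightarrow> t2 list"
  assumes H: "H \<in> carrier (S3 \<theta>)"
    and H_invertible: "to_loc \<theta> (abs_sq (S3 \<theta>) H) \<in> Units (S3loc \<theta>)"
    and lam_mu: "lam \<noteq> 0" "mu \<noteq> 0" "(cmod lam)\<^sup>2 + (cmod mu)\<^sup>2 = 1"
    and sphere: "s3_calculus \<theta> d C"
    and metric:
      "matrix_form (S3loc \<theta>) (s3_module \<theta>) {1, 2, 3} (s3_basis \<theta>)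
        (s3_metric_matrix \<theta> (to_loc \<theta> H)) h"
    and connection: "levi_civita C h nab"
    and torus: "t2_calculus \<theta> \<delta> C'"
    and phi: "phi \<in> star_alg_hom (S3loc \<theta>) (T2 \<theta>)"
      "phi (Zel \<theta>) = cscale (T2 \<theta>) lam (Uel \<theta>)"
      "phi (Wel \<theta>) = cscale (T2 \<theta>) mu (Vel \<theta>)"
    and psi: "lie_hom (T2 \<theta>) (rc_lie C') (S3loc \<theta>) (rc_lie C) psi"
      "psi (\<delta> 1) = d 1"
      "psi (\<delta> 2) = d 2"
    and psihat:
      "\<And>a b. a \<in> carrier (S3loc \<theta>) \<Longrightarrow> b \<in> carrier (S3loc \<theta>) \<Longrightarrow>
        psihat (ract (s3_module \<theta>) (s3_basis \<theta> 1) a \<oplus>\<^bsub>s3_module \<theta>\<^esub>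
                ract (s3_module \<theta>) (s3_basis \<theta> 2) b) =
          ract (t2_module \<theta>) (t2_basis \<theta> 1) (phi a) \<oplus>\<^bsub>t2_module \<theta>\<^esub>
          ract (t2_module \<theta>) (t2_basis \<theta> 2) (phi b)"
    and induced_metric: "hermitian_form (T2 \<theta>) (t2_module \<theta>) h'"
      "h' (t2_basis \<theta> 1) (t2_basis \<theta> 1) =
        cscale (T2 \<theta>) (of_real ((cmod lam)\<^sup>2)) (phi (to_loc \<theta> (abs_sq (S3 \<theta>) H)))"
      "h' (t2_basis \<theta> 1) (t2_basis \<theta> 2) = \<zero>\<^bsub>T2 \<theta>\<^esub>"
      "h' (t2_basis \<theta> 2) (t2_basis \<theta> 1) = \<zero>\<^bsub>T2 \<theta>\<^esub>"
      "h' (t2_basis \<theta> 2) (t2_basis \<theta> 2) =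
        cscale (T2 \<theta>) (of_real ((cmod mu)\<^sup>2)) (phi (to_loc \<theta> (abs_sq (S3 \<theta>) H)))"
    and hinv:
      "inverse_matrix (T2 \<theta>) {1, 2} (\<lambda>i j. h' (t2_basis \<theta> i) (t2_basis \<theta> j)) hinv"
  shows "minimal_embedding C h nab (s3_tangent_module \<theta>) (T2 \<theta>) {1, 2} \<delta> hinv phi psi \<longleftrightarrow>
    phi (d 3 (to_loc \<theta> (abs_sq (S3 \<theta>) H))) =
      cscale (T2 \<theta>) (of_real ((cmod lam)\<^sup>2 - (cmod mu)\<^sup>2)) (phi (to_loc \<theta> (abs_sq (S3 \<theta>) H)))"
proof -

  \<comment> \<open>Invertible and self-adjoint metric entries\<close>
  let ?A = "S3loc \<theta>" and ?B = "T2 \<theta>" and ?E = "s3_basis \<theta>"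
  define G where "G = to_loc \<theta> H"
  define z where "z = abs_sq ?A (Zel \<theta>)"
  define w where "w = abs_sq ?A (Wel \<theta>)"
  define k where "k = abs_sq ?A G"
  define K where "K = s3_metric_matrix \<theta> G"
  have k_eq: "to_loc \<theta> (abs_sq (S3 \<theta>) H) = k"
    using H by (simp add: k_def G_def to_loc_abs_sq)
  have G: "G \<in> carrier ?A"
    using H by (simp add: G_def to_loc_closed)
  have units: "z \<in> Units ?A" "w \<in> Units ?A" "k \<in> Units ?A"
    using H_invertible by (simp_all add: k_eq z_def w_def abs_sq_Units)
  have cl: "z \<in> carrier ?A" "w \<in> carrier ?A" "k \<in> carrier ?A"
    using units by (auto intro: S3loc.Units_closed)
  have self_adj: "adj ?A z = z" "adj ?A w = w" "adj ?A k = k"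
    using G by (simp_all add: z_def w_def k_def S3loc.adj_abs_sq Zel_closed Wel_closed)
  have central: "a \<otimes>\<^bsub>?A\<^esub> z = z \<otimes>\<^bsub>?A\<^esub> a" "a \<otimes>\<^bsub>?A\<^esub> w = w \<otimes>\<^bsub>?A\<^esub> a"
    if "a \<in> carrier ?A" for a
    using that by (simp_all add: z_def w_def abs_sq_Zel_central abs_sq_Wel_central)
  note comm = central[OF cl(3)] central(1)[OF cl(2)]
  have k_zw: "k \<otimes>\<^bsub>?A\<^esub> (z \<otimes>\<^bsub>?A\<^esub> w) = z \<otimes>\<^bsub>?A\<^esub> w \<otimes>\<^bsub>?A\<^esub> k"
    using cl by (metis comm(1,2) S3loc.m_assoc)
  have K: "K 1 1 = z \<otimes>\<^bsub>?A\<^esub> k" "K 2 2 = w \<otimes>\<^bsub>?A\<^esub> k" "K 3 3 = z \<otimes>\<^bsub>?A\<^esub> w \<otimes>\<^bsub>?A\<^esub> k"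
    using s3_metric_matrix_diagonal[OF G] by (simp_all add: K_def z_def w_def k_def)
  have I: "insert 3 {1, 2} = {1, 2, 3 :: nat}" by auto

  \<comment> \<open>Tangent and normal directions\<close>
  interpret S: orthogonal_hypersurface ?A "s3_module \<theta>" 3 "{1, 2}" ?E K h
  proof (intro orthogonal_hypersurface.intro orthogonal_frame.intro orthogonal_frame_axioms.intro
      orthogonal_hypersurface_axioms.intro, unfold I)
    show "star_algebra ?A" by (rule S3loc.star_algebra_axioms)
    show "right_module ?A (s3_module \<theta>)" by (rule s3_module_right_module)
    show "?E \<in> {1, 2, 3} \<rightarrow> carrier (s3_module \<theta>)" by (rule s3_basis_in_s3_module)
    show "carrier (s3_module \<theta>) = lincomb (s3_module \<theta>) {1, 2, 3} ?E ` ({1, 2, 3} \<rightarrow> carrier ?A)"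
      by (rule s3_module_spanning)
    show "matrix_form ?A (s3_module \<theta>) {1, 2, 3} ?E K h"
      using metric by (simp add: K_def G_def)
    show "K i j = \<zero>\<^bsub>?A\<^esub>" if "i \<noteq> j" for i j
      using that G by (simp add: K_def s3_metric_matrix_def Let_def S3loc.adj_closed)
    show "K i i \<in> Units ?A" if "i \<in> {1, 2, 3}" for i
      using that units K by auto
    \<comment> \<open>The adjoint reverses the factors, and centrality of \<open>z\<close> and
      \<open>w\<close> restores their order.\<close>
    show "adj ?A (K i i) = K i i" if "i \<in> {1, 2, 3}" for i
      using that K cl comm k_zw by (auto simp: S3loc.adj_mult self_adj)
  qed auto

  \<comment> \<open>Commuting derivations and the Koszul formula\<close>
  have der: "s3_derivations \<theta> d"
    and C: "rc_alg C = ?A" "rc_mod C = s3_module \<theta>"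
    and lie: "rc_lie C = lie_generated ?A (d ` {1, 2, 3})"
    and real_lin: "real_linear ?A (rc_lie C) (s3_module \<theta>) (rc_map C)"
    using sphere unfolding s3_calculus_def by blast+
  have map: "rc_map C (d i) = ?E i" if "i \<in> {1, 2, 3}" for i
    using sphere that unfolding s3_calculus_def by blast
  note herm = hermitian_s3_derivations[OF der]
  have herm': "hermitian_derivation ?A (d i)" if "i \<in> {1, 2}" for i
    using that herm by auto
  have g: "d i \<in> rc_lie C" if "i \<in> {1, 2, 3}" for i
    using that by (auto simp: lie intro: lie_generated.gen)
  have bracket: "rc_map C (der_bracket ?A (d i) (d 3)) = \<zero>\<^bsub>s3_module \<theta>\<^esub>" if "i \<in> {1, 2}" for i
  proof -
    \<comment> \<open>The zero derivation is written as 0 times \<open>d 1\<close>, so that real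
      linearity of \<open>rc_map\<close> gives its image. Outside the carrier both functions are
      \<open>undefined\<close>.\<close>
    have "der_bracket ?A (d i) (d 3) = der_scale ?A 0 (d 1)"
    proof
      fix a
      show "der_bracket ?A (d i) (d 3) a = der_scale ?A 0 (d 1) a"
      proof (cases "a \<in> carrier ?A")
        case True
        then show ?thesis
          using s3_derivations_commute[OF der that] S3loc.derivation_closed[OF herm(1) True]
          by (simp add: der_scale_def S3loc.cscale_zero_left)
      qed (simp add: der_scale_def der_bracket_def)
    qed
    then have "rc_map C (der_bracket ?A (d i) (d 3)) = rscale ?A (s3_module \<theta>) 0 (rc_map C (d 1))"
      using real_lin g[of 1] by (simp add: real_linear_def)
    then show ?thesis
      using S.frame[of 1] map[of 1]
      by (simp add: rscale_def S3loc.cscale_zero_left S.M.ract_zero_right)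
  qed
  have koszul: "h (?E 3) (nab (d i) (?E i)) = cscale ?A (- 1 / 2) (d 3 (K i i))"
    if "i \<in> {1, 2}" for i
proof -
    have i: "i \<in> {1, 2, 3}" "i \<in> insert 3 {1, 2}" and normal: "3 \<in> {1, 2, 3 :: nat}"
      and "i \<noteq> 3" using that by auto
    then have orth: "h (?E 3) (?E i) = \<zero>\<^bsub>?A\<^esub>" "h (?E i) (?E i) = K i i"
      using S.form_frame[OF _ i(2)] by simp_all
    have "h (rc_map C (d 3)) (nab (d i) (rc_map C (d i))) =
        cscale ?A (- 1 / 2) (d 3 (h (rc_map C (d i)) (rc_map C (d i))))"
      by (rule S.levi_civita_commuting_orthogonal[OF connection C g[OF i(1)] g[OF normal] herm'[OF that]
          herm(3) _ _ bracket[OF that]])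
        (simp_all only: map[OF i(1)] map[OF normal] orth S.frame[OF i(2)] S.normal_closed)
    then show ?thesis
      by (simp only: map[OF i(1)] map[OF normal] orth)
  qed

  \<comment> \<open>Images of the metric entries in the torus\<close>
  define \<kappa> where "\<kappa> = phi k"
  define \<rho> where "\<rho> = phi (d 3 k)"
  define p where "p = (cmod lam)\<^sup>2"
  define r where "r = (cmod mu)\<^sup>2"
  have pr: "p \<noteq> 0" "r \<noteq> 0"
    using lam_mu by (simp_all add: p_def r_def)
  note hom = star_alg_homD(1)[OF phi(1)]
  have d3k: "d 3 k \<in> carrier ?A"
    by (rule S3loc.derivation_closed[OF herm(3) cl(3)])
  have \<kappa>: "\<kappa> \<in> Units ?B"
    unfolding \<kappa>_def by (rule ring_hom_Units[OF hom S3loc.monoid_axioms units(3)])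
  have \<kappa>\<rho>: "\<kappa> \<in> carrier ?B" "\<rho> \<in> carrier ?B" "inv\<^bsub>?B\<^esub> \<kappa> \<in> carrier ?B"
    using T2.Units_closed[OF \<kappa>] T2.Units_inv_closed[OF \<kappa>] ring_hom_closed[OF hom d3k]
    by (simp_all add: \<rho>_def)
  have phi_z: "phi z = cscale ?B p \<one>\<^bsub>?B\<^esub>" and phi_w: "phi w = cscale ?B r \<one>\<^bsub>?B\<^esub>"
    using star_alg_hom_abs_sq[OF phi(1) S3loc.star_algebra_axioms]
    by (simp_all add: z_def w_def p_def r_def phi(2,3) Zel_closed Wel_closed T2.abs_sq_cscale
        Uel_closed Vel_closed abs_sq_torus_gens)
  have d3z: "d 3 z = cscale ?A 2 (z \<otimes>\<^bsub>?A\<^esub> w)" and d3w: "d 3 w = \<ominus>\<^bsub>?A\<^esub> d 3 z"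
    using s3_derivation_abs_sq(3)[OF der] derivation_abs_sq_Wel[OF herm(3)]
    by (simp_all add: z_def w_def)
  have phi_d3z: "phi (d 3 z) = cscale ?B (2 * p * r) \<one>\<^bsub>?B\<^esub>"
    using cl by (simp add: d3z star_alg_homD(3)[OF phi(1)] ring_hom_mult[OF hom] phi_z phi_w
        T2.cscale_mult_left T2.cscale_mult_right T2.cscale_cscale T2.cscale_closed mult_ac)
  have phi_d3w: "phi (d 3 w) = cscale ?B (- (2 * p * r)) \<one>\<^bsub>?B\<^esub>"
  proof -
    have "d 3 z \<in> carrier ?A" by (rule S3loc.derivation_closed[OF herm(3) cl(1)])
    then have "phi (d 3 w) = cscale ?B (-1) (phi (d 3 z))"
      by (simp add: d3w S3loc.cscale_minus_one[symmetric] star_alg_homD(3)[OF phi(1)])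
    then show ?thesis
      by (simp add: phi_d3z T2.cscale_cscale)
  qed
  \<comment> \<open>The Leibniz rule for a metric entry \<open>a k\<close>, where \<open>x\<close>
    and \<open>y\<close> are the scalars to which \<open>d 3 a\<close> and \<open>a\<close> are
    sent. It is applied to \<open>z\<close> and \<open>w\<close>.\<close>
  have phi_d3K: "phi (d 3 (a \<otimes>\<^bsub>?A\<^esub> k)) = cscale ?B x \<kappa> \<oplus>\<^bsub>?B\<^esub> cscale ?B y \<rho>"
    if "a \<in> carrier ?A" "phi (d 3 a) = cscale ?B x \<one>\<^bsub>?B\<^esub>" "phi a = cscale ?B y \<one>\<^bsub>?B\<^esub>"
    for a x y
    using that cl d3k \<kappa>\<rho> S3loc.derivation_closed[OF herm(3)]
    by (simp add: S3loc.derivation_mult[OF herm(3)] ring_hom_add[OF hom] ring_hom_mult[OF hom]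
        T2.cscale_mult_left flip: \<kappa>_def \<rho>_def)

  \<comment> \<open>A logarithmic derivative of the conformal factor. The inverse stands on the
    right because \<open>hinv\<close> multiplies from there and \<open>\<rho>\<close> may fail to
    commute with \<open>\<kappa>\<close>.\<close>
  define \<sigma> where "\<sigma> = \<rho> \<otimes>\<^bsub>?B\<^esub> inv\<^bsub>?B\<^esub> \<kappa>"
  have \<sigma>: "\<sigma> \<in> carrier ?B"
    using \<kappa>\<rho> by (simp add: \<sigma>_def)

  \<comment> \<open>The inverse of the induced metric\<close>
  let ?K' = "\<lambda>i j. h' (t2_basis \<theta> i) (t2_basis \<theta> j)"
  have K': "?K' 1 1 = cscale ?B p \<kappa>" "?K' 2 2 = cscale ?B r \<kappa>"
    "?K' 1 2 = \<zero>\<^bsub>?B\<^esub>" "?K' 2 1 = \<zero>\<^bsub>?B\<^esub>"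
    using induced_metric by (simp_all add: k_eq p_def r_def \<kappa>_def del: One_nat_def)
  have N: "hinv i j = (if i = j then inv\<^bsub>?B\<^esub> (?K' i i) else \<zero>\<^bsub>?B\<^esub>)"
    if "i \<in> {1, 2}" "j \<in> {1, 2}" for i j
    using that K' T2.inv_cscale(1)[OF \<kappa>] pr
    by (intro T2.inverse_matrix_diagonal[OF hinv]) (auto simp del: One_nat_def)
  have N': "hinv 1 1 = cscale ?B (1 / p) (inv\<^bsub>?B\<^esub> \<kappa>)" "hinv 2 2 = cscale ?B (1 / r) (inv\<^bsub>?B\<^esub> \<kappa>)"
    using N[of 1 1] N[of 2 2] K' T2.inv_cscale(2)[OF \<kappa>] pr by (simp_all del: One_nat_def)
  have h_closed: "d 3 (K i i) \<in> carrier ?A" if "i \<in> {1, 2}" for i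
    using that S.diagonal_closed[of i] S3loc.derivation_closed[OF herm(3)] by auto
  \<comment> \<open>The factor -1/2 comes from the Koszul formula. The inverse metric cancels
    \<open>\<kappa>\<close> in the first summand and the scalar \<open>y\<close> in the
    second.\<close>
  have term_eq: "phi (h (?E 3) (nab (d i) (?E i))) \<otimes>\<^bsub>?B\<^esub> cscale ?B (1 / y) (inv\<^bsub>?B\<^esub> \<kappa>) =
      cscale ?B (- x / (y * 2)) \<one>\<^bsub>?B\<^esub> \<oplus>\<^bsub>?B\<^esub> cscale ?B (- 1 / 2) \<sigma>"
    if "i \<in> {1, 2}" "phi (d 3 (K i i)) = cscale ?B x \<kappa> \<oplus>\<^bsub>?B\<^esub> cscale ?B y \<rho>" "y \<noteq> 0" for i x y
    using that \<kappa>\<rho> \<kappa> \<sigma> h_closed[OF that(1)]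
    by (simp add: koszul star_alg_homD(3)[OF phi(1)] T2.l_distr T2.cscale_add T2.cscale_mult_left
        T2.cscale_mult_right T2.cscale_cscale T2.cscale_closed flip: \<sigma>_def)
  have nab_closed: "nab (psi (\<delta> i)) (rc_map C (psi (\<delta> j))) \<in> carrier (s3_module \<theta>)"
    if "i \<in> {1, 2}" "j \<in> {1, 2}" for i j
  proof -
    have "psi (\<delta> i) = d i" "psi (\<delta> j) = d j" using that psi(2,3) by auto
    then show ?thesis
      using that connection g[of i] map[of j] S.frame[of j]
      by (auto simp: levi_civita_def Let_def affine_connection_def C)
  qed

  \<comment> \<open>Evaluation of the mean curvature\<close>
  have "minimal_embedding C h nab (s3_tangent_module \<theta>) ?B {1, 2} \<delta> hinv phi psi \<longleftrightarrow>
      (\<Oplus>\<^bsub>?B\<^esub>i\<in>{1, 2}. phi (h (?E 3) (nab (psi (\<delta> i)) (rc_map C (psi (\<delta> i))))) \<otimes>\<^bsub>?B\<^esub> hinv i i) = \<zero>\<^bsub>?B\<^esub>"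
    unfolding s3_tangent_module_def
    by (rule S.minimal_embedding_iff)
      (use nab_closed hinv N in \<open>auto simp: T2.star_algebra_axioms phi(1) C inverse_matrix_def\<close>)
  also have "(\<Oplus>\<^bsub>?B\<^esub>i\<in>{1, 2}. phi (h (?E 3) (nab (psi (\<delta> i)) (rc_map C (psi (\<delta> i))))) \<otimes>\<^bsub>?B\<^esub> hinv i i) =
      (cscale ?B (- r) \<one>\<^bsub>?B\<^esub> \<oplus>\<^bsub>?B\<^esub> cscale ?B (- 1 / 2) \<sigma>) \<oplus>\<^bsub>?B\<^esub>
      (cscale ?B p \<one>\<^bsub>?B\<^esub> \<oplus>\<^bsub>?B\<^esub> cscale ?B (- 1 / 2) \<sigma>)"
  proof -
    have "phi (h (?E 3) (nab (d 1) (?E 1))) \<otimes>\<^bsub>?B\<^esub> hinv 1 1 =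
        cscale ?B (- r) \<one>\<^bsub>?B\<^esub> \<oplus>\<^bsub>?B\<^esub> cscale ?B (- 1 / 2) \<sigma>"
      \<comment> \<open>Here \<open>x = 2 p r\<close> and \<open>y = p\<close>, so
        \<open>- x / (2 y)\<close> equals \<open>- r\<close>.\<close>
      using term_eq[of 1 "2 * p * r" p] phi_d3K[OF cl(1) phi_d3z phi_z] pr by (simp add: K N' del: One_nat_def)
    moreover have "phi (h (?E 3) (nab (d 2) (?E 2))) \<otimes>\<^bsub>?B\<^esub> hinv 2 2 =
        cscale ?B p \<one>\<^bsub>?B\<^esub> \<oplus>\<^bsub>?B\<^esub> cscale ?B (- 1 / 2) \<sigma>"
      \<comment> \<open>The opposite sign of \<open>d 3 w\<close> gives \<open>x = - 2 p r\<close>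
        with \<open>y = r\<close>, so \<open>- x / (2 y)\<close> equals \<open>p\<close>.\<close>
      using term_eq[of 2 "- (2 * p * r)" r] phi_d3K[OF cl(2) phi_d3w phi_w] pr by (simp add: K N' del: One_nat_def)
    ultimately show ?thesis
      using \<sigma> psi(2,3) map[of 1] map[of 2]
      by (simp add: T2.cscale_closed del: One_nat_def)
  qed
  also have "\<dots> = cscale ?B (p - r) \<one>\<^bsub>?B\<^esub> \<ominus>\<^bsub>?B\<^esub> \<sigma>"
  proof -
    have "cscale ?B (- 1 / 2) \<sigma> \<oplus>\<^bsub>?B\<^esub> cscale ?B (- 1 / 2) \<sigma> = \<ominus>\<^bsub>?B\<^esub> \<sigma>"
      using \<sigma> T2.add_cscale[of \<sigma> \<theta> "- 1 / 2" "- 1 / 2"] by (simp add: T2.cscale_minus_one)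
    moreover have "cscale ?B p \<one>\<^bsub>?B\<^esub> \<oplus>\<^bsub>?B\<^esub> cscale ?B (- r) \<one>\<^bsub>?B\<^esub> = cscale ?B (p - r) \<one>\<^bsub>?B\<^esub>"
      using T2.add_cscale[of "\<one>\<^bsub>?B\<^esub>" \<theta> p "- r"] by simp
    ultimately show ?thesis
      using \<sigma> by (simp add: T2.minus_eq T2.a_ac T2.cscale_closed)
  qed
  also have "\<dots> = \<zero>\<^bsub>?B\<^esub> \<longleftrightarrow> \<sigma> = cscale ?B (p - r) \<one>\<^bsub>?B\<^esub>"
    using \<sigma> by (simp add: T2.cscale_closed T2.minus_eq_zero_iff) (rule eq_commute)
  \<comment> \<open>Right multiplication by \<open>\<kappa>\<close> or by its inverse passes between
    the two equations.\<close>
  also have "\<dots> \<longleftrightarrow> \<rho> = cscale ?B (p - r) \<kappa>"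
  proof
    assume "\<sigma> = cscale ?B (p - r) \<one>\<^bsub>?B\<^esub>"
    then have "\<rho> \<otimes>\<^bsub>?B\<^esub> inv\<^bsub>?B\<^esub> \<kappa> \<otimes>\<^bsub>?B\<^esub> \<kappa> = cscale ?B (p - r) \<kappa>"
      using \<kappa>\<rho> by (simp add: \<sigma>_def T2.cscale_mult_left)
    then show "\<rho> = cscale ?B (p - r) \<kappa>"
      using \<kappa>\<rho> \<kappa> by (simp add: T2.m_assoc)
  qed (use \<kappa>\<rho> \<kappa> in \<open>simp add: \<sigma>_def T2.cscale_mult_left\<close>)
  finally show ?thesis
    by (simp add: k_eq \<rho>_def \<kappa>_def p_def r_def)
qed

end
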